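(* Let $\ell\ge3$ and $d\ge1$ be integers. For $\sigma\in\{0,1\}$ and $n\in\mathbb N$ let $z^\ell_{d,\sigma}(n)$ be the number of charged $\ell$-partitions $|\boldsymbol\lambda,\boldsymbol\sigma\rangle$ of rank $n$ with $\sigma_1+\dots+\sigma_\ell=\sigma$ that are spetsial $d$-cores. Then: (1) $z^\ell_{d,1}(n)>0$ for all $n\in\mathbb N$ if and only if $\ell d\ge4$; (2) $z^\ell_{d,0}(n)>0$ for all $n\in\mathbb N$ if and only if $\ell d\ge5$.
   Context: $\mathbb N=\{0,1,2,\dots\}$. A partition $\lambda=(\lambda_1\ge\lambda_2\ge\cdots)$ is a weakly decreasing sequence in $\mathbb N$ with finitely many nonzero terms. A charged $\ell$-partition $|\boldsymbol\lambda,\boldsymbol\sigma\rangle$ is a pair of an $\ell$-tuple $\boldsymbol\lambda=(\lambda^1,\dots,\lambda^\ell)$ of partitions and a charge $\boldsymbol\sigma=(\sigma_1,\dots,\sigma_\ell)\in\mathbb Z^\ell$; its symbol is $(S^{(1)},\dots,S^{(\ell)})$ with $S^{(j)}=\{\lambda^j_k-k+1+\sigma_j : k\ge1\}\subset\mathbb Z$. A spetsial $d$-hook is some $\beta\in S^{(j)}$ with $\beta-d\notin S^{(j+1)}$ (superscripts mod $\ell$, so $S^{(\ell+1)}=S^{(1)}$). A charged $\ell$-partition is a spetsial $d$-core if its symbol has no spetsial $d$-hook. Rank of a charged $\ell$-partition: let $m=\max\{z\in\mathbb Z : z\notin S^{(j)}\text{ for some }j\}$, let $c$ be the number of pairs $(\beta,j)$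 with $\beta\in S^{(j)}$, $\beta\ge m$, and put $\mathrm{rk}(|\boldsymbol\lambda,\boldsymbol\sigma\rangle)=\sum_{j}\sum_{\beta\in S^{(j)},\beta\ge m}\beta-cm-\left\lfloor\frac{(c-1)(c-\ell+1)}{2\ell}\right\rfloor$.
   Formalization: In the definition of rank, m is taken as the minimum, not the maximum, of the integers z with z not in S^(j) for some j, since each S^(j) is bounded above and so no maximum exists. *)

theory Defs
  imports Main
begin

(* All indices start at 0: lam k stands for the (k+1)-st part, and component j < l
   for the (j+1)-st entry of a tuple. *)

definition is_partition :: "(nat \<Rightarrow> nat) \<Rightarrow> bool" where
  "is_partition lam \<longleftrightarrow> antimono lam \<and> finite {k. lam k \<noteq> 0}"

type_synonym charged_tuple = "(nat \<Rightarrow> nat) list \<times> int list"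

definition charged_partition :: "nat \<Rightarrow> charged_tuple \<Rightarrow> bool" where
  "charged_partition l P \<longleftrightarrow>
     length (fst P) = l \<and> length (snd P) = l \<and> (\<forall>lam \<in> set (fst P). is_partition lam)"

definition beta_set :: "(nat \<Rightarrow> nat) \<Rightarrow> int \<Rightarrow> int set" where
  "beta_set lam s = {int (lam k) - int k + s | k. True}"

definition symbol :: "charged_tuple \<Rightarrow> int set list" where
  "symbol P = map2 beta_set (fst P) (snd P)"

definition spetsial_hook :: "nat \<Rightarrow> int set list \<Rightarrow> int \<Rightarrow> nat \<Rightarrow> bool" where
  "spetsial_hook d S \<beta> j \<longleftrightarrow>
     j < length S \<and> \<beta> \<in> S ! j \<and> \<beta> - int d \<notin> S ! (Suc j mod length S)"

definition spetsial_core :: "nat \<Rightarrow> charged_tuple \<Rightarrow> bool" where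
  "spetsial_core d P \<longleftrightarrow> \<not> (\<exists>\<beta> j. spetsial_hook d (symbol P) \<beta> j)"

(* Components of a symbol are bounded above and contain every sufficiently negative
   integer. So the integers missing from some component have no maximum, and the
   cut-off in the rank has to be the least of them. Any cut-off below it would give
   the same rank. *)
definition cutoff :: "int set list \<Rightarrow> int" where
  "cutoff S = (LEAST z. \<exists>j < length S. z \<notin> S ! j)"

(* div on int rounds towards minus infinity, hence is the floor of the quotient *)
definition charged_rank :: "charged_tuple \<Rightarrow> int" where
  "charged_rank P =
     (let S = symbol P;
          l = int (length S);
          m = cutoff S;
          c = int (card {(\<beta>, j). j < length S \<and> \<beta> \<in> S ! j \<and> \<beta> \<ge> m})
      in (\<Sum>j<length S. \<Sum>\<beta> \<in> {\<beta> \<in> S ! j. \<beta> \<ge> m}. \<beta>)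
           - c * m - ((c - 1) * (c - l + 1)) div (2 * l))"

definition num_cores :: "nat \<Rightarrow> nat \<Rightarrow> int \<Rightarrow> nat \<Rightarrow> nat" where
  "num_cores l d s n =
     card {P. charged_partition l P \<and> charged_rank P = int n \<and> sum_list (snd P) = s \<and> spetsial_core d P}"

end

theory Submission
  imports Defs "HOL-Library.Infinite_Set"
begin

text \<open>
  A symbol without spetsial \<open>d\<close>-hooks shifts into the next component under subtraction of \<open>d\<close>. Regrouping
  its entries along the orbits of \<open>(\<beta>, j) \<mapsto> (\<beta> - d, j + 1)\<close> gives \<open>l\<close> sets of integers each closed under
  subtraction of \<open>d\<close>, that is, \<open>l\<close> independent abaci with \<open>d\<close> runners. If the charges add up to \<open>0\<close> or \<open>1\<close>, the rank is
  the sum of \<open>\<bar>\<beta> - 1\<bar>\<close> over all entries \<open>\<beta> > 0\<close> and all gaps \<open>\<beta> \<le> 0\<close> (\<open>charged_rank_eq_energy\<close>). Hence only finitely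
  many charged partitions have a given rank, and cores of rank \<open>n\<close> exist iff
  \<open>n = (\<Sum>a<l. \<Sum>r<d. d N\<^sub>a\<^sub>r (N\<^sub>a\<^sub>r - 1) / 2 + r N\<^sub>a\<^sub>r)\<close> with \<open>(\<Sum>a<l. \<Sum>r<d. N\<^sub>a\<^sub>r) = \<sigma>\<close>
  has an integral solution \<open>N\<close>.

  For \<open>d = 1\<close> this asks for \<open>l\<close> integers with sum \<open>\<sigma>\<close> and sum of squares \<open>2 n + \<sigma>\<close>. The exceptions are then small:
  \<open>7\<close> is not a sum of three squares, which excludes \<open>n = 3\<close> for \<open>l = 3\<close>, \<open>\<sigma> = 1\<close>, and neither is \<open>28\<close>, which
  excludes \<open>n = 14\<close> for \<open>l \<le> 4\<close>, \<open>\<sigma> = 0\<close>.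

  In the other cases all \<open>n\<close> are represented because every natural number is a sum of three triangular
  numbers (\<open>sum_of_three_hexagonal\<close>). For \<open>d = 1\<close>, \<open>l = 4\<close>, \<open>\<sigma> = 1\<close> the statement is equivalent to this theorem of Gauss.
  For even \<open>d\<close> three staircase partitions realize three triangular numbers, for odd \<open>d \<ge> 5\<close> one finds three
  mutually orthogonal directions in the lattice of the \<open>N\<close> along which the form is, up to a constant, \<open>d\<close> times a
  triangular number (\<open>realizable_odd\<close>), and for \<open>d = 3\<close> four runners carry integers with prescribed sum, sum of squares and
  residues modulo \<open>3\<close> (\<open>realizable_3_3\<close>). More components only help.

  Gauss's theorem is proved by comparing, for \<open>N\<close> congruent to \<open>3\<close> modulo \<open>8\<close>, the number of representations of \<open>N\<close> by three
  odd squares with the number of solutions of \<open>P Q + Q R + R P = N\<close> in odd positive integers. Both satisfy the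
  recursion that expresses the logarithmic derivative of the cube of a theta series: for the squares by symmetry, for the
  products by an explicit sign-reversing involution (\<open>sum_positive_pair_quadruples\<close>). So they agree up to the factor \<open>8\<close>,
  and \<open>P = Q = 1\<close> is an obvious solution.
\<close>

section \<open>Charge and energy of sets of integers\<close>

text \<open>A set of integers is compared with the vacuum \<open>{..0}\<close>, the component of the empty partition with
charge \<open>0\<close>. The components of symbols are exactly the sets with a finite deviation; the weights
\<open>1\<close> and \<open>b - 1\<close> of the deviating elements give charge and energy. The shift in \<open>b - 1\<close> makes the entry
\<open>1\<close>, the first one above the vacuum, free of energy.\<close>
definition deviation :: "int set \<Rightarrow> int set" where
  "deviation S = {b. (b \<in> S) \<noteq> (b \<le> 0)}"

definition excess :: "(int \<Rightarrow> int) \<Rightarrow> int set \<Rightarrow> int" where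
  "excess w S = (\<Sum>b \<in> deviation S. w b * (of_bool (b \<in> S) - of_bool (b \<le> 0)))"

abbreviation charge :: "int set \<Rightarrow> int" where "charge \<equiv> excess (\<lambda>_. 1)"
abbreviation energy :: "int set \<Rightarrow> int" where "energy \<equiv> excess (\<lambda>b. b - 1)"
abbreviation maya :: "int set \<Rightarrow> bool" where "maya S \<equiv> finite (deviation S)"

text \<open>Sums over a common window are linear in the indicator of \<open>S\<close>, whereas the deviation itself depends on \<open>S\<close>.\<close>
lemma excess_window:
  assumes "finite F" "deviation S \<subseteq> F"
  shows "excess w S = (\<Sum>b \<in> F. w b * (of_bool (b \<in> S) - of_bool (b \<le> 0)))"
  unfolding excess_def by (rule sum.mono_neutral_left) (use assms in \<open>auto simp: deviation_def\<close>)

lemma maya_bounds: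
  assumes "maya S"
  obtains L U where "L \<le> 0" "{..L} \<subseteq> S" "S \<subseteq> {..U}"
proof -
  define K where "K = Max (insert 0 (abs ` deviation S))"
  have K: "\<bar>b\<bar> \<le> K" if "b \<in> deviation S" for b
    unfolding K_def by (rule Max_ge) (use assms that in auto)
  have "0 \<le> K" unfolding K_def by (rule Max_ge) (use assms in auto)
  have far: "b \<in> S \<longleftrightarrow> b \<le> 0" if "K < \<bar>b\<bar>" for b
    using K[of b] that by (auto simp: deviation_def)
  show ?thesis
  proof (rule that[of "- K - 1" K])
    show "- K - 1 \<le> 0" using \<open>0 \<le> K\<close> by simp
    show "{..- K - 1} \<subseteq> S" using far \<open>0 \<le> K\<close> by auto
    show "S \<subseteq> {..K}"
    proof
      fix b assume "b \<in> S"
      then show "b \<in> {..K}" using far[of b] \<open>0 \<le> K\<close> by (cases "K < \<bar>b\<bar>") auto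
    qed
  qed
qed

lemma deviation_cut:
  assumes "{..L} \<subseteq> S" "S \<subseteq> {..U}" "L \<le> 0"
  shows "deviation S \<subseteq> {L<..max U 0}"
proof
  fix b assume "b \<in> deviation S"
  moreover have "b \<in> S" "b \<le> 0" if "b \<le> L" using assms that by auto
  moreover have "b \<notin> S" if "max U 0 < b" using assms(2) that by auto
  ultimately show "b \<in> {L<..max U 0}" by (force simp: deviation_def)
qed

lemma maya_of_cut:
  assumes "{..L} \<subseteq> S" "S \<subseteq> {..U}" "L \<le> 0"
  shows "maya S"
  by (rule finite_subset[OF deviation_cut[OF assms]]) simp

lemma finite_above_cut:
  assumes "S \<subseteq> {..U}"
  shows "finite (S \<inter> {L::int<..})"
  by (rule finite_subset[of _ "{L<..U}"]) (use assms in auto)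

text \<open>Counting from a cut-off \<open>L\<close> below which nothing is missing, as the rank does.\<close>
lemma excess_cut:
  assumes "{..L} \<subseteq> S" "S \<subseteq> {..U}" "L \<le> 0"
  shows "excess w S = sum w (S \<inter> {L<..}) - sum w {L<..0}"
proof -
  let ?F = "{L<..max U 0}"
  have "excess w S = (\<Sum>b\<in>?F. w b * of_bool (b \<in> S)) - (\<Sum>b\<in>?F. w b * of_bool (b \<le> 0))"
    by (subst excess_window[OF _ deviation_cut[OF assms]])
      (auto simp: right_diff_distrib sum_subtractf)
  also have "(\<Sum>b\<in>?F. w b * of_bool (b \<in> S)) = sum w (?F \<inter> {b. b \<in> S})"
    by (rule sum_mult_of_bool_eq) simp
  also have "?F \<inter> {b. b \<in> S} = S \<inter> {L<..}" using assms by auto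
  also have "(\<Sum>b\<in>?F. w b * of_bool (b \<le> 0)) = sum w (?F \<inter> {b. b \<le> 0})"
    by (rule sum_mult_of_bool_eq) simp
  also have "?F \<inter> {b. b \<le> 0} = {L<..0}" by auto
  finally show "excess w S = sum w (S \<inter> {L<..}) - sum w {L<..0}" .
qed

lemma charge_cut:
  assumes "{..L} \<subseteq> S" "S \<subseteq> {..U}" "L \<le> 0"
  shows "charge S = int (card (S \<inter> {L<..})) + L"
  using excess_cut[OF assms, of "\<lambda>_. 1"] assms(3) by simp

text \<open>Every deviating \<open>b\<close> contributes \<open>\<bar>b - 1\<bar>\<close> to the energy, and no contribution is negative.\<close>
lemma deviation_of_energy_le:
  assumes "maya S" "energy S \<le> n"
  shows "deviation S \<subseteq> {1 - n..1 + n}"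
proof
  fix b assume b: "b \<in> deviation S"
  have "\<bar>b - 1\<bar> = (b - 1) * (of_bool (b \<in> S) - of_bool (b \<le> 0))"
    using b by (auto simp: deviation_def)
  also have "\<dots> \<le> energy S"
    unfolding excess_def
    by (rule member_le_sum[OF b]) (use assms in \<open>auto simp: deviation_def\<close>)
  finally show "b \<in> {1 - n..1 + n}" using assms by auto
qed

lemma energy_nonneg: "0 \<le> energy S"
  unfolding excess_def by (rule sum_nonneg) (auto simp: deviation_def)

lemma finite_maya_energy_le: "finite {S. maya S \<and> energy S \<le> n}"
proof (rule finite_subset)
  show "{S. maya S \<and> energy S \<le> n} \<subseteq> deviation -` Pow {1 - n..1 + n}"
    using deviation_of_energy_le by auto
  have "inj deviation"
    by (rule injI) (auto simp: deviation_def set_eq_iff)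
  then show "finite (deviation -` Pow {1 - n..1 + n})"
    by (intro finite_vimageI) auto
qed

section \<open>Partitions and their components\<close>

lemma beta_set_cut:
  assumes lam: "is_partition lam"
  obtains K where "beta_set lam s = (\<lambda>k. int (lam k) - int k + s) ` {..<K} \<union> {..s - int K}"
    "inj_on (\<lambda>k. int (lam k) - int k + s) {..<K}"
    "(\<lambda>k. int (lam k) - int k + s) ` {..<K} \<subseteq> {s - int K<..}"
proof -
  let ?f = "\<lambda>k. int (lam k) - int k + s"
  have "finite {k. lam k \<noteq> 0}" using lam by (simp add: is_partition_def)
  then obtain K where "{k. lam k \<noteq> 0} \<subseteq> {..<K}" by (auto simp: finite_nat_iff_bounded)
  then have K: "lam k = 0" if "k \<ge> K" for k using that by force
  have anti: "lam k \<le> lam j" if "j \<le> k" for j k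
    using lam that by (auto simp: is_partition_def antimono_def)
  have "beta_set lam s = ?f ` {..<K} \<union> ?f ` {K..}"
  proof -
    have "beta_set lam s = range ?f" by (auto simp: beta_set_def)
    also have "UNIV = {..<K} \<union> {K..}" by auto
    finally show ?thesis by (simp only: image_Un)
  qed
  also have "?f ` {K..} = {..s - int K}"
  proof (intro subset_antisym subsetI)
    fix b assume "b \<in> {..s - int K}"
    then show "b \<in> ?f ` {K..}"
      by (intro image_eqI[of _ _ "nat (s - b)"]) (auto simp: K)
  qed (auto simp: K)
  finally have "beta_set lam s = ?f ` {..<K} \<union> {..s - int K}" .
  moreover have "inj_on ?f {..<K}"
  proof (rule inj_onI)
    fix j k assume "?f j = ?f k"
    then show "j = k" using anti[of j k] anti[of k j] by (cases j k rule: linorder_cases) auto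
  qed
  moreover have "?f ` {..<K} \<subseteq> {s - int K<..}" by auto
  ultimately show ?thesis by (rule that)
qed

lemma maya_and_charge_beta_set:
  assumes "is_partition lam"
  shows "maya (beta_set lam s) \<and> charge (beta_set lam s) = s"
proof
  let ?f = "\<lambda>k. int (lam k) - int k + s"
  obtain K where K: "beta_set lam s = ?f ` {..<K} \<union> {..s - int K}" "inj_on ?f {..<K}"
    "?f ` {..<K} \<subseteq> {s - int K<..}"
    using beta_set_cut[OF assms, of s] .
  define L where "L = min (s - int K) 0"
  define U where "U = Max (insert (s - int K) (?f ` {..<K}))"
  have L: "{..L} \<subseteq> beta_set lam s" "L \<le> 0" by (auto simp: L_def K(1))
  have U: "beta_set lam s \<subseteq> {..U}"
  proof
    fix b assume "b \<in> beta_set lam s"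
    moreover have "c \<le> U" if "c \<in> insert (s - int K) (?f ` {..<K})" for c
      unfolding U_def by (rule Max_ge) (use that in auto)
    ultimately show "b \<in> {..U}" unfolding K(1) by force
  qed
  show "maya (beta_set lam s)" using maya_of_cut[OF L(1) U L(2)] .
  have "beta_set lam s \<inter> {L<..} = ?f ` {..<K} \<union> {L<..s - int K}"
    using K(3) unfolding K(1) by (auto simp: L_def)
  moreover have "card (?f ` {..<K} \<union> {L<..s - int K}) = card (?f ` {..<K}) + card {L<..s - int K}"
    by (rule card_Un_disjoint) (use K(3) in auto)
  ultimately have "int (card (beta_set lam s \<inter> {L<..})) = s - L"
    using K(2) by (simp add: card_image L_def)
  then show "charge (beta_set lam s) = s"
    using charge_cut[OF L(1) U L(2)] by simp
qed

lemma maya_beta_set: "is_partition lam \<Longrightarrow> maya (beta_set lam s)"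
  by (simp add: maya_and_charge_beta_set)

lemma charge_beta_set: "is_partition lam \<Longrightarrow> charge (beta_set lam s) = s"
  by (simp add: maya_and_charge_beta_set)

text \<open>The charge recovers \<open>s\<close>, and a strictly decreasing sequence is determined by its range.\<close>
lemma beta_set_inj:
  assumes "is_partition lam" "is_partition mu" and eq: "beta_set lam s = beta_set mu t"
  shows "lam = mu \<and> s = t"
proof -
  have "s = t" using assms charge_beta_set by metis
  have anti: "int (nu k) - int k < int (nu j) - int j" if "j < k" "is_partition nu" for nu j k
  proof -
    have "nu k \<le> nu j" using that by (auto simp: is_partition_def antimono_def)
    then show ?thesis using that by linarith
  qed
  have le: "int (nu k) - int k \<le> int (xi k) - int k"
    if nu: "is_partition nu" and xi: "is_partition xi"
      and sub: "beta_set nu s \<subseteq> beta_set xi s" and IH: "\<And>j. j < k \<Longrightarrow> nu j = xi j" for nu xi k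
  proof -
    have "int (nu k) - int k + s \<in> beta_set nu s" by (auto simp: beta_set_def)
    then have "int (nu k) - int k + s \<in> beta_set xi s" using sub by auto
    then obtain j where j: "int (nu k) - int k = int (xi j) - int j" by (auto simp: beta_set_def)
    have "\<not> j < k" using anti[OF _ nu, of j k] IH[of j] j by auto
    then show ?thesis using anti[OF _ xi, of k j] j by (cases "j = k") auto
  qed
  have "lam k = mu k" for k
  proof (induction k rule: less_induct)
    case (less k)
    then show ?case
      using le[of lam mu k] le[of mu lam k] assms \<open>s = t\<close> by fastforce
  qed
  then show ?thesis using \<open>s = t\<close> by auto
qed

text \<open>The elements of \<open>S\<close> are listed downwards by enumerating their distances \<open>U - b\<close> to an upper bound.
From some index on the distances grow by exactly one, which is where the partition becomes zero and what
determines the charge.\<close>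
lemma maya_is_beta_set:
  assumes "maya S"
  obtains lam s where "is_partition lam" "S = beta_set lam s"
proof -
  obtain L U where LU: "L \<le> 0" "{..L} \<subseteq> S" "S \<subseteq> {..U}" using maya_bounds[OF assms] .
  define T where "T = {x :: nat. U - int x \<in> S}"
  define M where "M = nat (U - L)"
  have M: "x \<in> T" if "M \<le> x" for x
    using LU that by (auto simp: T_def M_def)
  have inf: "infinite T"
    unfolding infinite_nat_iff_unbounded_le using M by (meson max.cobounded1 max.cobounded2)
  let ?e = "enumerate T"
  have step: "?e (Suc k) > ?e k" for k using inf by (rule enumerate_step)
  have ge: "k \<le> ?e k" for k using inf by (rule le_enumerate)
  have const: "?e (M + k) = ?e M + k" for k
  proof (induction k)
    case (Suc k)
    have "Suc (?e (M + k)) \<in> T" using ge[of "M + k"] by (intro M) simp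
    then have "?e (Suc (M + k)) \<le> Suc (?e (M + k))"
      unfolding enumerate_Suc''[OF inf] by (intro Least_le) simp
    then show ?case using step[of "M + k"] Suc by simp
  qed simp
  define D where "D = int (?e M) - int M"
  have mono: "int (?e k) - int k \<le> int (?e j) - int j" if "k \<le> j" for k j
    using that
  proof (induction j rule: dec_induct)
    case (step n)
    then show ?case using \<open>\<And>k. ?e (Suc k) > ?e k\<close>[of n] by linarith
  qed simp
  have leD: "int (?e k) - int k \<le> D" for k
  proof (cases "k \<le> M")
    case True
    then show ?thesis using mono D_def by simp
  next
    case False
    then show ?thesis using const[of "k - M"] by (simp add: D_def)
  qed
  define s where "s = U - D"
  define lam where "lam k = nat (D - (int (?e k) - int k))" for k
  have lam: "int (lam k) = D - (int (?e k) - int k)" for k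
    using leD[of k] by (simp add: lam_def)
  have "is_partition lam"
    unfolding is_partition_def
  proof
    show "antimono lam"
      by (rule antimonoI) (use mono in \<open>force simp: lam_def intro: nat_mono\<close>)
    have "lam k = 0" if "k \<ge> M" for k
      using const[of "k - M"] that by (simp add: lam_def D_def)
    then have "{k. lam k \<noteq> 0} \<subseteq> {..<M}" by (auto simp: not_less intro: ccontr)
    then show "finite {k. lam k \<noteq> 0}" by (rule finite_subset) simp
  qed
  moreover have "S = beta_set lam s"
  proof -
    have "beta_set lam s = range (\<lambda>k. U - int (?e k))"
      by (auto simp: beta_set_def lam s_def image_def)
    also have "\<dots> = (\<lambda>x. U - int x) ` range ?e" by auto
    also have "range ?e = T" using inf by (rule range_enumerate)
    also have "(\<lambda>x. U - int x) ` T = S"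
    proof (intro subset_antisym subsetI)
      fix b assume "b \<in> S"
      then show "b \<in> (\<lambda>x. U - int x) ` T"
        using LU(3) by (intro image_eqI[of _ _ "nat (U - b)"]) (auto simp: T_def)
    qed (auto simp: T_def)
    finally show ?thesis by simp
  qed
  ultimately show ?thesis by (rule that)
qed

section \<open>Rank and energy of symbols\<close>

lemma symbol_nth:
  "charged_partition l P \<Longrightarrow> j < l \<Longrightarrow> symbol P ! j = beta_set (fst P ! j) (snd P ! j)"
  by (auto simp: charged_partition_def symbol_def)

lemma is_partition_nth: "charged_partition l P \<Longrightarrow> j < l \<Longrightarrow> is_partition (fst P ! j)"
  by (auto simp: charged_partition_def)

lemma length_symbol: "charged_partition l P \<Longrightarrow> length (symbol P) = l"
  by (simp add: charged_partition_def symbol_def)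

lemma symbol_maya: "charged_partition l P \<Longrightarrow> j < l \<Longrightarrow> maya (symbol P ! j)"
  by (simp add: symbol_nth is_partition_nth maya_beta_set)

lemma sum_charge_symbol:
  assumes "charged_partition l P"
  shows "sum_list (snd P) = (\<Sum>j<l. charge (symbol P ! j))"
proof -
  have "sum_list (snd P) = (\<Sum>j<l. snd P ! j)"
    using assms by (simp add: sum_list_sum_nth charged_partition_def atLeast0LessThan)
  also have "\<dots> = (\<Sum>j<l. charge (symbol P ! j))"
    by (rule sum.cong) (use assms in \<open>auto simp: symbol_nth is_partition_nth charge_beta_set\<close>)
  finally show ?thesis .
qed

lemma Least_int_le:
  fixes P :: "int \<Rightarrow> bool"
  assumes "P z" and "\<And>z. P z \<Longrightarrow> B \<le> z"
    and "P x"
  shows "Least P \<le> x"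
proof -
  let ?A = "{x \<in> {B..z}. P x}"
  have *: "finite ?A" "?A \<noteq> {}"
    using assms by (auto intro: finite_subset[of _ "{B..z}"])
  define m where "m = Min ?A"
  have "P m" using Min_in[OF *] by (simp add: m_def)
  moreover have "m \<le> x" if "P x" for x
  proof (cases "x \<le> z")
    case True
    then show ?thesis using Min_le[OF *(1), of x] that assms(2) by (simp add: m_def)
  next
    case False
    then show ?thesis using Min_in[OF *] by (simp add: m_def)
  qed
  ultimately have "Least P = m" by (rule Least_equality)
  then show ?thesis using \<open>\<And>x. P x \<Longrightarrow> m \<le> x\<close> assms(3) by simp
qed

lemma sum_shifted_below_zero:
  "2 * (\<Sum>b \<in> {- int w<..0}. b - 1) = - int w * (int w + 1)"
proof (induction w)
  case (Suc w)
  have "{- int (Suc w)<..0} = insert (- int w) {- int w<..0}" by auto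
  then show ?case using Suc by (simp add: algebra_simps)
qed simp

text \<open>Let \<open>1 - w\<close> be the cut-off and \<open>c\<close> the number of entries from there on, so that \<open>c = \<sigma> + l w\<close>. Then
both sides are quadratic in \<open>w\<close>, and the division in the rank is exact for \<open>\<sigma> = 1\<close> and leaves the
remainder \<open>l - 1\<close> for \<open>\<sigma> = 0\<close>.\<close>
lemma charged_rank_eq_energy:
  assumes P: "charged_partition l P" and l: "2 \<le> l"
    and sigma: "sum_list (snd P) = 0 \<or> sum_list (snd P) = 1"
  shows "charged_rank P = (\<Sum>j<l. energy (symbol P ! j))"
proof -
  define S where "S j = symbol P ! j" for j
  define \<sigma> where "\<sigma> = sum_list (snd P)"
  have len: "length (symbol P) = l" using P by (rule length_symbol)
  have maya: "maya (S j)" if "j < l" for j using symbol_maya[OF P that] by (simp add: S_def)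
  have "\<exists>L U. L \<le> 0 \<and> {..L} \<subseteq> S j \<and> S j \<subseteq> {..U}" if "j < l" for j
    using maya_bounds[OF maya[OF that]] by metis
  then obtain Lf Uf where LU: "\<And>j. j < l \<Longrightarrow> Lf j \<le> (0 :: int) \<and> {..Lf j} \<subseteq> S j \<and> S j \<subseteq> {..Uf j}"
    by metis
  define m where "m = cutoff (symbol P)"
  let ?Q = "\<lambda>z. \<exists>j<l. z \<notin> S j"
  have m_eq: "m = Least ?Q" by (simp add: m_def cutoff_def len S_def)
  have Q0: "?Q (Uf 0 + 1)" using LU[of 0] l by (intro exI[of _ 0]) auto
  have QB: "Min (Lf ` {..<l}) \<le> z" if Qz: "?Q z" for z
  proof -
    obtain j where j: "j < l" "z \<notin> S j" using Qz by auto
    have "Min (Lf ` {..<l}) \<le> Lf j" by (rule Min_le) (use j in auto)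
    moreover have "Lf j < z" using LU[OF j(1)] j(2) by (meson atMost_iff linorder_not_less subsetD)
    ultimately show ?thesis by simp
  qed
  have below: "{..m - 1} \<subseteq> S j" if "j < l" for j
  proof
    fix z assume "z \<in> {..m - 1}"
    then have "\<not> m \<le> z" by simp
    then have "\<not> ?Q z" using Least_int_le[of ?Q, OF Q0 QB, of z] unfolding m_eq by blast
    then show "z \<in> S j" using that by blast
  qed
  have sum\<sigma>: "(\<Sum>j<l. charge (S j)) = \<sigma>"
    unfolding S_def \<sigma>_def by (rule sum_charge_symbol[OF P, symmetric])
  \<comment> \<open>Otherwise every component would have positive charge, against \<open>\<sigma> < l\<close>.\<close>
  have m1: "m \<le> 1"
  proof (rule ccontr)
    assume "\<not> m \<le> 1"
    have "1 \<le> charge (S j)" if "j < l" for j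
    proof -
      have s0: "{..0} \<subseteq> S j" and "1 \<in> S j" using below[OF that] \<open>\<not> m \<le> 1\<close> by auto
      have "S j \<subseteq> {..Uf j}" using LU that by auto
      note c = finite_above_cut[OF this, of 0] charge_cut[OF s0 this]
      have "0 < card (S j \<inter> {0<..})"
        using c(1) \<open>1 \<in> S j\<close> by (subst card_gt_0_iff) auto
      then show ?thesis using c(2) by simp
    qed
    then have "(\<Sum>j<l. 1) \<le> (\<Sum>j<l. charge (S j))" by (intro sum_mono) auto
    then show False using sum\<sigma> sigma l by (simp add: \<sigma>_def)
  qed
  define w where "w = nat (1 - m)"
  have w: "m = 1 - int w" using m1 by (simp add: w_def)
  define T where "T = (\<Sum>b \<in> {- int w<..0}. b - 1)"
  have T: "2 * T = - int w * (int w + 1)" unfolding T_def by (rule sum_shifted_below_zero)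
  define V where "V j = {b \<in> S j. b \<ge> m}" for j
  have V: "V j = S j \<inter> {- int w<..}" for j by (auto simp: V_def w)
  have cut: "{..- int w} \<subseteq> S j" "S j \<subseteq> {..Uf j}" "- int w \<le> 0" if "j < l" for j
    using below[OF that] LU[OF that] by (auto simp: w)
  have finV: "finite (V j)" if "j < l" for j
    using finite_above_cut[OF cut(2)[OF that]] by (simp add: V)
  have chV: "int (card (V j)) = charge (S j) + int w" if "j < l" for j
    using charge_cut[OF cut[OF that]] by (simp add: V)
  have enV: "\<Sum>(V j) = energy (S j) + T + int (card (V j))" if "j < l" for j
    using excess_cut[OF cut[OF that], of "\<lambda>b. b - 1"] by (simp add: V T_def sum_subtractf)
  define c where "c = int (card {(b, j). j < l \<and> b \<in> S j \<and> m \<le> b})"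
  have "{(b, j). j < l \<and> b \<in> S j \<and> m \<le> b} = prod.swap ` (SIGMA j : {..<l}. V j)"
    by (auto simp: V_def)
  then have "c = int (card (SIGMA j : {..<l}. V j))"
    by (simp add: c_def card_image)
  also have "\<dots> = (\<Sum>j<l. int (card (V j)))" using finV by simp
  finally have c_sum: "c = (\<Sum>j<l. int (card (V j)))" .
  also have "\<dots> = (\<Sum>j<l. charge (S j) + int w)" by (rule sum.cong) (auto simp: chV)
  also have "\<dots> = \<sigma> + int l * int w" by (simp add: sum.distrib sum\<sigma>)
  finally have c: "c = \<sigma> + int l * int w" .
  have "(\<Sum>j<l. \<Sum>(V j)) = (\<Sum>j<l. energy (S j) + T + int (card (V j)))"
    by (rule sum.cong) (auto simp: enV)
  also have "\<dots> = (\<Sum>j<l. energy (S j)) + int l * T + c"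
    by (simp add: sum.distrib c_sum)
  finally have E: "(\<Sum>j<l. \<Sum>(V j)) = (\<Sum>j<l. energy (S j)) + int l * T + c" .
  have "((c - 1) * (c - int l + 1)) div (2 * int l) = c * int w + int l * T"
  proof (rule int_div_pos_eq)
    have T': "2 * (int l * (int l * T)) = - (int l * (int l * (int w * (int w + 1))))"
      using T by (metis (no_types, lifting) mult.left_commute mult_minus_left mult_minus_right)
    show "(c - 1) * (c - int l + 1) =
        2 * int l * (c * int w + int l * T) + (if \<sigma> = 0 then int l - 1 else 0)"
      using sigma T' by (auto simp: \<sigma>_def[symmetric] c algebra_simps)
  qed (use l in auto)
  moreover have "charged_rank P = (\<Sum>j<l. \<Sum>(V j)) - c * m - ((c - 1) * (c - int l + 1)) div (2 * int l)"
    unfolding charged_rank_def Let_def len m_def[symmetric] S_def[symmetric]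
    by (simp add: c_def V_def)
  ultimately show ?thesis
    unfolding E by (simp add: w algebra_simps S_def)
qed

lemma finite_charged_partitions_energy:
  "finite {P. charged_partition l P \<and> (\<Sum>j<l. energy (symbol P ! j)) = n}"
proof (rule finite_imageD[of symbol])
  let ?A = "{P. charged_partition l P \<and> (\<Sum>j<l. energy (symbol P ! j)) = n}"
  have "symbol ` ?A \<subseteq> {xs. set xs \<subseteq> {S. maya S \<and> energy S \<le> n} \<and> length xs = l}"
  proof clarify
    fix lams ss assume P: "charged_partition l (lams, ss)"
      and n: "n = (\<Sum>j<l. energy (symbol (lams, ss) ! j))"
    let ?S = "symbol (lams, ss)"
    have len: "length ?S = l" using P by (rule length_symbol)
    have "maya (?S ! j) \<and> energy (?S ! j) \<le> n" if "j < l" for j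
      unfolding n using symbol_maya[OF P that] that
      by (auto intro!: member_le_sum energy_nonneg)
    then show "set ?S \<subseteq> {S. maya S \<and> energy S \<le> (\<Sum>j<l. energy (?S ! j))} \<and> length ?S = l"
      unfolding n using len by (auto simp: in_set_conv_nth)
  qed
  then show "finite (symbol ` ?A)"
    by (rule finite_subset) (rule finite_lists_length_eq[OF finite_maya_energy_le])
  show "inj_on symbol ?A"
  proof (rule inj_onI)
    fix P Q assume "P \<in> ?A" "Q \<in> ?A" and eq: "symbol P = symbol Q"
    then have P: "charged_partition l P" and Q: "charged_partition l Q" by auto
    have "fst P ! j = fst Q ! j \<and> snd P ! j = snd Q ! j" if "j < l" for j
      using beta_set_inj is_partition_nth[OF P that] is_partition_nth[OF Q that]
        symbol_nth[OF P that] symbol_nth[OF Q that] eq by metis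
    then show "P = Q"
      using P Q by (auto simp: charged_partition_def intro!: prod_eqI nth_equalityI)
  qed
qed

section \<open>Untwisting spetsial cores\<close>

definition rotate_index :: "nat \<Rightarrow> int \<Rightarrow> nat \<Rightarrow> nat" where
  "rotate_index l x j = nat ((x + int j) mod int l)"

lemma rotate_index_less: "0 < l \<Longrightarrow> rotate_index l x j < l"
  by (simp add: rotate_index_def nat_less_iff)

lemma bij_rotate_index:
  assumes "0 < l"
  shows "bij_betw (rotate_index l x) {..<l} {..<l}"
proof (rule bij_betw_byWitness[where f' = "rotate_index l (- x)"])
  show "\<forall>j \<in> {..<l}. rotate_index l (- x) (rotate_index l x j) = j"
    "\<forall>j \<in> {..<l}. rotate_index l x (rotate_index l (- x) j) = j"
    using assms by (simp_all add: rotate_index_def mod_simps)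
qed (use rotate_index_less[OF assms] in auto)

lemma maya_twist:
  fixes g :: "int \<Rightarrow> int"
  assumes l: "0 < l" and Y: "\<And>a. a < l \<Longrightarrow> maya (Y a)"
  shows "maya {b. b \<in> Y (rotate_index l (g b) j)}"
proof (rule finite_subset)
  show "deviation {b. b \<in> Y (rotate_index l (g b) j)} \<subseteq> (\<Union>a<l. deviation (Y a))"
    using rotate_index_less[OF l] by (fastforce simp: deviation_def)
qed (use Y in auto)

text \<open>Permuting the components separately at every integer \<open>b\<close> changes no sum over all components.\<close>
lemma excess_twist:
  fixes g :: "int \<Rightarrow> int"
  assumes l: "0 < l" and Y: "\<And>a. a < l \<Longrightarrow> maya (Y a)"
  shows "(\<Sum>j<l. excess w {b. b \<in> Y (rotate_index l (g b) j)}) = (\<Sum>a<l. excess w (Y a))"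
proof -
  define S where "S = (\<lambda>j. {b. b \<in> Y (rotate_index l (g b) j)})"
  define F where "F = (\<Union>a<l. deviation (Y a))"
  have fin: "finite F" using Y by (auto simp: F_def)
  have S: "deviation (S j) \<subseteq> F" for j
    using rotate_index_less[OF l] by (fastforce simp: F_def S_def deviation_def)
  have Y': "deviation (Y a) \<subseteq> F" if "a < l" for a using that by (auto simp: F_def)
  let ?h = "\<lambda>b a. w b * (of_bool (b \<in> Y a) - of_bool (b \<le> 0))"
  have "(\<Sum>j<l. excess w (S j)) = (\<Sum>j<l. \<Sum>b\<in>F. ?h b (rotate_index l (g b) j))"
    by (rule sum.cong) (auto simp: excess_window[OF fin S], simp add: S_def)
  also have "\<dots> = (\<Sum>b\<in>F. \<Sum>j<l. ?h b (rotate_index l (g b) j))" by (rule sum.swap)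
  also have "\<dots> = (\<Sum>b\<in>F. \<Sum>a<l. ?h b a)"
    by (rule sum.cong[OF refl], rule sum.reindex_bij_betw[OF bij_rotate_index[OF l]])
  also have "\<dots> = (\<Sum>a<l. \<Sum>b\<in>F. ?h b a)" by (rule sum.swap)
  also have "\<dots> = (\<Sum>a<l. excess w (Y a))"
    by (rule sum.cong) (auto simp: excess_window[OF fin Y'])
  finally show ?thesis unfolding S_def .
qed

lemma spetsial_core_iff:
  assumes "charged_partition l P"
  shows "spetsial_core d P \<longleftrightarrow>
    (\<forall>j<l. \<forall>b \<in> symbol P ! j. b - int d \<in> symbol P ! (Suc j mod l))"
  using length_symbol[OF assms] by (auto simp: spetsial_core_def spetsial_hook_def)

definition closed_under :: "nat \<Rightarrow> int set \<Rightarrow> bool" where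
  "closed_under d Y \<longleftrightarrow> (\<forall>b \<in> Y. b - int d \<in> Y)"

text \<open>What remains of spetsial cores after untwisting: every component is closed on its own, instead of each one
shifting into the next.\<close>
definition realizable :: "nat \<Rightarrow> nat \<Rightarrow> int \<Rightarrow> int \<Rightarrow> bool" where
  "realizable l d s n \<longleftrightarrow> (\<exists>Y. (\<forall>a<l. maya (Y a) \<and> closed_under d (Y a))
     \<and> (\<Sum>a<l. charge (Y a)) = s \<and> (\<Sum>a<l. energy (Y a)) = n)"

lemma charged_partition_of_maya:
  assumes "\<And>j. j < l \<Longrightarrow> maya (S j)"
  obtains P where "charged_partition l P" "\<And>j. j < l \<Longrightarrow> symbol P ! j = S j"
proof -
  have "\<exists>lam s. is_partition lam \<and> S j = beta_set lam s" if "j < l" for j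
    using maya_is_beta_set[OF assms[OF that]] by metis
  then obtain lam s where ls: "\<And>j. j < l \<Longrightarrow> is_partition (lam j) \<and> S j = beta_set (lam j) (s j)"
    by metis
  show ?thesis
    by (rule that[of "(map lam [0..<l], map s [0..<l])"])
      (use ls in \<open>auto simp: charged_partition_def symbol_def\<close>)
qed

text \<open>Subtracting \<open>d\<close> lowers \<open>b div d\<close> by one, which compensates the passage from component \<open>j\<close> to \<open>j + 1\<close>.
So if the entry \<open>b\<close> of component \<open>j\<close> is taken from the set with index \<open>b div d + j\<close>, closure under \<open>d\<close> of these
sets turns into the absence of hooks.\<close>
lemma core_of_realizable:
  assumes d: "0 < d" and l: "0 < l" and "realizable l d s n"
  obtains P where "charged_partition l P" "spetsial_core d P" "sum_list (snd P) = s"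
    "(\<Sum>j<l. energy (symbol P ! j)) = n"
proof -
  obtain Y where Y: "\<And>a. a < l \<Longrightarrow> maya (Y a)" "\<And>a. a < l \<Longrightarrow> closed_under d (Y a)"
    "(\<Sum>a<l. charge (Y a)) = s" "(\<Sum>a<l. energy (Y a)) = n"
    using assms(3) by (auto simp: realizable_def)
  define S where "S j = {b. b \<in> Y (rotate_index l (b div int d) j)}" for j
  have maya: "maya (S j)" for j unfolding S_def by (rule maya_twist[OF l Y(1)])
  have twist: "(\<Sum>j<l. excess w (S j)) = (\<Sum>a<l. excess w (Y a))" for w
    unfolding S_def by (rule excess_twist[OF l Y(1)])
  obtain P where P: "charged_partition l P" "\<And>j. j < l \<Longrightarrow> symbol P ! j = S j"
    using charged_partition_of_maya[of l S] maya by metis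
  have "b - int d \<in> S (Suc j mod l)" if "b \<in> S j" "j < l" for b j
  proof -
    have "(b - int d) div int d = b div int d - 1"
      using div_mult_self1[of "int d" b "- 1"] d by simp
    then have "rotate_index l ((b - int d) div int d) (Suc j mod l) = rotate_index l (b div int d) j"
      by (simp add: rotate_index_def zmod_int mod_simps)
    then show ?thesis
      using that Y(2)[OF rotate_index_less[OF l]] by (auto simp: S_def closed_under_def)
  qed
  then have "spetsial_core d P" unfolding spetsial_core_iff[OF P(1)] using P(2) l by auto
  moreover have "sum_list (snd P) = s"
    using sum_charge_symbol[OF P(1)] P(2) twist[of "\<lambda>_. 1"] Y(3) by simp
  moreover have "(\<Sum>j<l. energy (symbol P ! j)) = n"
    using P(2) twist[of "\<lambda>b. b - 1"] Y(4) by simp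
  ultimately show ?thesis using P(1) that by blast
qed

text \<open>The inverse twist; for \<open>d = 1\<close> the quotient \<open>b div d\<close> is \<open>b\<close> itself.\<close>
lemma realizable_of_unit_core:
  assumes l: "0 < l" and P: "charged_partition l P" and core: "spetsial_core 1 P"
  shows "realizable l 1 (sum_list (snd P)) (\<Sum>j<l. energy (symbol P ! j))"
proof -
  define Y where "Y a = {b. b \<in> symbol P ! rotate_index l (- b) a}" for a
  have maya: "maya (Y a)" for a unfolding Y_def by (rule maya_twist[OF l symbol_maya[OF P]])
  have twist: "(\<Sum>a<l. excess w (Y a)) = (\<Sum>j<l. excess w (symbol P ! j))" for w
    unfolding Y_def by (rule excess_twist[OF l symbol_maya[OF P]])
  have "b - 1 \<in> Y a" if "b \<in> Y a" for a b
  proof -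
    have "rotate_index l (- (b - 1)) a = Suc (rotate_index l (- b) a) mod l"
    proof -
      have "int (rotate_index l (- (b - 1)) a) = int (Suc (rotate_index l (- b) a) mod l)"
        using l by (simp add: rotate_index_def zmod_int mod_simps algebra_simps)
      then show ?thesis by simp
    qed
    moreover have "b - int 1 \<in> symbol P ! (Suc (rotate_index l (- b) a) mod l)"
      using that core[unfolded spetsial_core_iff[OF P]] rotate_index_less[OF l]
      unfolding Y_def by blast
    ultimately show ?thesis by (simp add: Y_def)
  qed
  then show ?thesis
    unfolding realizable_def
    by (intro exI[of _ Y]) (auto simp: closed_under_def maya twist sum_charge_symbol[OF P])
qed

text \<open>The cardinality of an infinite set would count as zero, so positivity needs the finiteness of the
set of all charged partitions of given energy.\<close>
lemma num_cores_pos_iff: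
  assumes "2 \<le> l" "s = 0 \<or> s = 1"
  shows "num_cores l d s n > 0 \<longleftrightarrow> (\<exists>P. charged_partition l P \<and> spetsial_core d P
     \<and> sum_list (snd P) = s \<and> (\<Sum>j<l. energy (symbol P ! j)) = int n)"
proof -
  let ?A = "{P. charged_partition l P \<and> charged_rank P = int n \<and> sum_list (snd P) = s \<and> spetsial_core d P}"
  let ?B = "{P. charged_partition l P \<and> spetsial_core d P
     \<and> sum_list (snd P) = s \<and> (\<Sum>j<l. energy (symbol P ! j)) = int n}"
  have "charged_rank P = (\<Sum>j<l. energy (symbol P ! j))"
    if "charged_partition l P" "sum_list (snd P) = s" for P
    by (rule charged_rank_eq_energy) (use assms that in auto)
  then have AB: "?A = ?B" by (intro Collect_cong) metis
  have "finite ?B"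
    by (rule finite_subset[OF _ finite_charged_partitions_energy[of l "int n"]]) auto
  then show ?thesis unfolding num_cores_def AB by (auto simp: card_gt_0_iff)
qed

lemma num_cores_pos_of_realizable:
  assumes "2 \<le> l" "0 < d" "s = 0 \<or> s = 1" "realizable l d s (int n)"
  shows "num_cores l d s n > 0"
proof -
  have "0 < l" using assms(1) by simp
  from core_of_realizable[OF assms(2) this assms(4)] show ?thesis
    unfolding num_cores_pos_iff[OF assms(1,3)] by metis
qed

lemma realizable_of_num_unit_cores_pos:
  assumes "2 \<le> l" "s = 0 \<or> s = 1" "num_cores l 1 s n > 0"
  shows "realizable l 1 s (int n)"
proof -
  obtain P where P: "charged_partition l P" "spetsial_core 1 P" "sum_list (snd P) = s"
    "(\<Sum>j<l. energy (symbol P ! j)) = int n"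
    using assms(3) unfolding num_cores_pos_iff[OF assms(1,2)] by blast
  have "0 < l" using assms(1) by simp
  from realizable_of_unit_core[OF this P(1,2)] show ?thesis unfolding P(3,4) .
qed

section \<open>Abaci\<close>

lemma telescope_below:
  fixes G :: "int \<Rightarrow> int"
  assumes "m \<le> n"
  shows "(\<Sum>q \<in> {m..<n}. G (q + 1) - G q) = G n - G m"
  using assms
proof (induction n rule: int_ge_induct)
  case (step n)
  have "{m..<n + 1} = insert n {m..<n}" using step.hyps by auto
  then show ?case using step.IH by simp
qed simp

text \<open>One runner of an abacus: beads fill all positions below \<open>N\<close>, the vacuum fills those below \<open>0\<close>.\<close>
lemma telescope_runner:
  fixes G :: "int \<Rightarrow> int"
  assumes "\<bar>N\<bar> \<le> K"
  shows "(\<Sum>q \<in> {-K..<K}. (G (q + 1) - G q) * (of_bool (q < N) - of_bool (q < 0))) = G N - G 0"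
proof -
  have "(\<Sum>q \<in> {-K..<K}. (G (q + 1) - G q) * of_bool (q < M)) = G M - G (- K)"
    if "\<bar>M\<bar> \<le> K" for M
  proof -
    have "{-K..<K} \<inter> {q. q < M} = {-K..<M}" using that by auto
    then show ?thesis using telescope_below[of "- K" M G] that by (simp add: sum_mult_of_bool_eq)
  qed
  from this[of N] this[of 0] show ?thesis
    using assms by (simp add: right_diff_distrib sum_subtractf)
qed

text \<open>The set closed under \<open>d\<close> in which the beads on runner \<open>r\<close>, the integers congruent to \<open>r + 1\<close> modulo \<open>d\<close>, fill
exactly the positions below \<open>N r\<close>.\<close>
definition abacus :: "nat \<Rightarrow> (nat \<Rightarrow> int) \<Rightarrow> int set" where
  "abacus d N = {b. (b - 1) div int d < N (nat ((b - 1) mod int d))}"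

text \<open>The sum of \<open>d q + r\<close> over \<open>0 \<le> q < x\<close> is \<open>d x (x - 1) / 2 + r x\<close>; the doubling avoids the division, also
for negative \<open>x\<close>.\<close>
definition twice_runner_energy :: "nat \<Rightarrow> nat \<Rightarrow> int \<Rightarrow> int" where
  "twice_runner_energy d r x = int d * x * (x - 1) + 2 * int r * x"

lemma twice_runner_energy_0 [simp]: "twice_runner_energy d r 0 = 0"
  by (simp add: twice_runner_energy_def)

lemma abacus_excess:
  assumes d: "0 < d" and G: "\<And>r q. r < d \<Longrightarrow> w (int d * q + int r + 1) = G r (q + 1) - G r q"
  shows "maya (abacus d N) \<and> excess w (abacus d N) = (\<Sum>r<d. G r (N r) - G r 0)"
proof
  define K where "K = Max ((\<lambda>r. \<bar>N r\<bar>) ` {..<d})"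
  have K: "\<bar>N r\<bar> \<le> K" if "r < d" for r unfolding K_def by (rule Max_ge) (use that in auto)
  define f where "f = (\<lambda>(r, q). int d * q + int r + 1)"
  define g where "g b = (nat ((b - 1) mod int d), (b - 1) div int d)" for b
  define D where "D = {..<d} \<times> {-K..<K}"
  have gf: "g (f x) = x" if "x \<in> D" for x
    using that by (auto simp: D_def f_def g_def)
  have fg: "f (g b) = b" for b using d by (simp add: f_def g_def)
  have dev: "deviation (abacus d N) \<subseteq> f ` D"
  proof
    fix b assume b: "b \<in> deviation (abacus d N)"
    define q where "q = (b - 1) div int d"
    define r where "r = nat ((b - 1) mod int d)"
    have r: "r < d" using d by (simp add: r_def nat_less_iff)
    have "b \<le> 0 \<longleftrightarrow> q < 0" using d by (auto simp: q_def pos_imp_zdiv_neg_iff)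
    then have "(q < N r) \<noteq> (q < 0)"
      using b by (simp add: deviation_def abacus_def q_def r_def)
    then have "- K \<le> q" "q < K" using K[OF r] by linarith+
    then have "(r, q) \<in> D" using r by (simp add: D_def)
    moreover have "b = f (r, q)" using fg[of b] by (simp add: g_def q_def r_def)
    ultimately show "b \<in> f ` D" by blast
  qed
  have fin: "finite (f ` D)" by (simp add: D_def)
  show "maya (abacus d N)" using finite_subset[OF dev fin] .
  have inj: "inj_on f D" using gf by (rule inj_on_inverseI)
  let ?h = "\<lambda>b. w b * (of_bool (b \<in> abacus d N) - of_bool (b \<le> 0))"
  have "excess w (abacus d N) = sum ?h (f ` D)" by (rule excess_window[OF fin dev])
  also have "\<dots> = (\<Sum>x\<in>D. ?h (f x))" using inj by (simp add: sum.reindex)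
  also have "\<dots> = (\<Sum>(r, q)\<in>D. (G r (q + 1) - G r q) * (of_bool (q < N r) - of_bool (q < 0)))"
  proof (rule sum.cong)
    fix x assume x: "x \<in> D"
    obtain r q where rq: "x = (r, q)" by (cases x)
    have r: "r < d" using x by (simp add: D_def rq)
    have "g (f x) = x" using x by (rule gf)
    then have "f x \<in> abacus d N \<longleftrightarrow> q < N r"
      by (simp add: g_def abacus_def rq)
    moreover have "f x \<le> 0 \<longleftrightarrow> q < 0"
    proof -
      have "(f x - 1) div int d = q" using \<open>g (f x) = x\<close> by (simp add: g_def rq)
      then show ?thesis using d pos_imp_zdiv_neg_iff[of "int d" "f x - 1"] by auto
    qed
    ultimately show "?h (f x) = (case x of (r, q) \<Rightarrow>
        (G r (q + 1) - G r q) * (of_bool (q < N r) - of_bool (q < 0)))"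
      using G[OF r, of q] by (simp add: rq f_def)
  qed simp
  also have "\<dots> = (\<Sum>r<d. \<Sum>q\<in>{-K..<K}. (G r (q + 1) - G r q) * (of_bool (q < N r) - of_bool (q < 0)))"
    unfolding D_def by (rule sum.cartesian_product[symmetric])
  also have "\<dots> = (\<Sum>r<d. G r (N r) - G r 0)"
    by (rule sum.cong) (auto intro: telescope_runner K)
  finally show "excess w (abacus d N) = (\<Sum>r<d. G r (N r) - G r 0)" .
qed

lemma excess_scale: "c * excess w S = excess (\<lambda>b. c * w b) S"
  by (simp add: excess_def sum_distrib_left mult.assoc)

lemma maya_abacus: "0 < d \<Longrightarrow> maya (abacus d N)"
  using abacus_excess[of d "\<lambda>_. 1" "\<lambda>_ q. q"] by simp

lemma charge_abacus: "0 < d \<Longrightarrow> charge (abacus d N) = (\<Sum>r<d. N r)"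
  using abacus_excess[of d "\<lambda>_. 1" "\<lambda>_ q. q"] by simp

lemma energy_abacus:
  assumes d: "0 < d"
  shows "2 * energy (abacus d N) = (\<Sum>r<d. twice_runner_energy d r (N r))"
proof -
  have "2 * energy (abacus d N) = excess (\<lambda>b. 2 * (b - 1)) (abacus d N)" by (rule excess_scale)
  also have "\<dots> = (\<Sum>r<d. twice_runner_energy d r (N r) - twice_runner_energy d r 0)"
    by (rule conjunct2[OF abacus_excess[OF d]]) (simp add: twice_runner_energy_def algebra_simps)
  finally show ?thesis by simp
qed

lemma closed_under_abacus:
  assumes d: "0 < d"
  shows "closed_under d (abacus d N)"
proof -
  have "(b - int d - 1) div int d = (b - 1) div int d - 1"
    "(b - int d - 1) mod int d = (b - 1) mod int d" for b
    using div_mult_self1[of "int d" "b - 1" "- 1"] mod_mult_self1[of "b - 1" "- 1" "int d"] d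
    by (simp_all add: algebra_simps)
  then show ?thesis by (auto simp: closed_under_def abacus_def)
qed

lemma realizable_abacus:
  assumes d: "0 < d" and s: "(\<Sum>a<l. \<Sum>r<d. N a r) = s"
    and n: "(\<Sum>a<l. \<Sum>r<d. twice_runner_energy d r (N a r)) = 2 * n"
  shows "realizable l d s n"
proof -
  have "2 * (\<Sum>a<l. energy (abacus d (N a))) = 2 * n"
    unfolding n[symmetric] by (simp add: sum_distrib_left energy_abacus[OF d])
  then show ?thesis
    unfolding realizable_def
    by (intro exI[of _ "\<lambda>a. abacus d (N a)"]) (simp add: maya_abacus[OF d] closed_under_abacus[OF d] charge_abacus[OF d] s)
qed

lemma closed_under_1_abacus:
  assumes "maya Y" "closed_under 1 Y"
  shows "Y = abacus 1 (\<lambda>_. charge Y)"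
proof -
  obtain L U where LU: "L \<le> 0" "{..L} \<subseteq> Y" "Y \<subseteq> {..U}" using maya_bounds[OF assms(1)] .
  define N where "N = Max (Y \<inter> {L..})"
  have fin: "finite (Y \<inter> {L..})" by (rule finite_subset[of _ "{L..U}"]) (use LU in auto)
  have L: "L \<in> Y \<inter> {L..}" using LU by auto
  have N: "N \<in> Y" using Max_in[OF fin] L by (auto simp: N_def)
  have "N - int k \<in> Y" for k
  proof (induction k)
    case (Suc k)
    then have "(N - int k) - int 1 \<in> Y" using assms(2) unfolding closed_under_def by blast
    then show ?case by (simp add: algebra_simps)
  qed (use N in simp)
  then have "b \<in> Y" if "b \<le> N" for b
    using that by (metis add_diff_cancel_left' diff_add_cancel zle_iff_zadd)
  moreover have "b \<le> N" if "b \<in> Y" for b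
  proof (cases "L \<le> b")
    case True
    then show ?thesis unfolding N_def by (intro Max_ge[OF fin]) (use that in auto)
  next
    case False
    then show ?thesis using Max_ge[OF fin L] by (simp add: N_def)
  qed
  ultimately have "Y = {..N}" by auto
  also have "\<dots> = abacus 1 (\<lambda>_. N)" by (auto simp: abacus_def)
  finally have Y: "Y = abacus 1 (\<lambda>_. N)" .
  have "charge Y = N" unfolding Y by (subst charge_abacus) auto
  then show ?thesis using Y by simp
qed

text \<open>A set closed under \<open>1\<close> is \<open>{..N}\<close>, with charge \<open>N\<close> and energy \<open>N (N - 1) / 2\<close>.\<close>
lemma realizable_1_imp_charges:
  assumes "realizable l 1 s n"
  obtains N :: "nat \<Rightarrow> int" where "(\<Sum>a<l. N a) = s" "(\<Sum>a<l. (N a)\<^sup>2) = 2 * n + s"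
proof -
  obtain Y where Y: "\<And>a. a < l \<Longrightarrow> maya (Y a)" "\<And>a. a < l \<Longrightarrow> closed_under 1 (Y a)"
    "(\<Sum>a<l. charge (Y a)) = s" "(\<Sum>a<l. energy (Y a)) = n"
    using assms by (auto simp: realizable_def)
  have "2 * energy (Y a) = (charge (Y a))\<^sup>2 - charge (Y a)" if "a < l" for a
  proof -
    have "2 * energy (Y a) = 2 * energy (abacus 1 (\<lambda>_. charge (Y a)))"
      using closed_under_1_abacus[OF Y(1,2)[OF that]] by metis
    also have "\<dots> = (charge (Y a))\<^sup>2 - charge (Y a)"
      by (subst energy_abacus)
        (auto simp: twice_runner_energy_def power2_eq_square algebra_simps)
    finally show ?thesis .
  qed
  then have "(\<Sum>a<l. 2 * energy (Y a)) = (\<Sum>a<l. (charge (Y a))\<^sup>2 - charge (Y a))"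
    by (intro sum.cong) auto
  then have "2 * n = (\<Sum>a<l. (charge (Y a))\<^sup>2) - s"
    using Y(3,4) by (simp add: sum_subtractf flip: sum_distrib_left)
  then show ?thesis using Y(3) by (intro that[of "\<lambda>a. charge (Y a)"]) auto
qed

section \<open>Sums of three triangular numbers\<close>

lemma sum_eq_0_by_sign_reversing:
  fixes g :: "'a \<Rightarrow> int"
  assumes T: "\<And>x. x \<in> A \<Longrightarrow> T x \<in> A" and TT: "\<And>x. x \<in> A \<Longrightarrow> T (T x) = x"
    and neg: "\<And>x. x \<in> A \<Longrightarrow> g (T x) = - g x"
  shows "sum g A = 0"
proof -
  have "sum g A = sum (\<lambda>x. g (T x)) A"
    by (rule sum.reindex_bij_witness[of _ T T]) (use T TT in auto)
  also have "\<dots> = - sum g A" using neg by (simp add: sum_negf)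
  finally show ?thesis by simp
qed

definition odd_square_triples :: "int \<Rightarrow> (int \<times> int \<times> int) set" where
  "odd_square_triples N = {(x, y, z). odd x \<and> odd y \<and> odd z \<and> x\<^sup>2 + y\<^sup>2 + z\<^sup>2 = N}"

text \<open>For \<open>N\<close> congruent to \<open>3\<close> modulo \<open>8\<close> these are the Selling parameters of the reduced positive definite binary
forms of discriminant \<open>- N\<close>, the form being \<open>(P x\<^sup>2 + Q y\<^sup>2 + R (x - y)\<^sup>2) / 2\<close>. So they are counted by a class
number, as the representations by three squares are.\<close>
definition odd_pair_product_triples :: "int \<Rightarrow> (int \<times> int \<times> int) set" where
  "odd_pair_product_triples N =
     {(P, Q, R). odd P \<and> odd Q \<and> odd R \<and> 0 < P \<and> 0 < Q \<and> 0 < R \<and> P * Q + Q * R + R * P = N}"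

lemma abs_le_square: "\<bar>x\<bar> \<le> x\<^sup>2" for x :: int
proof (cases "x = 0")
  case False
  then have "1 * \<bar>x\<bar> \<le> \<bar>x\<bar> * \<bar>x\<bar>" by (intro mult_right_mono) auto
  then show ?thesis by (simp add: power2_eq_square)
qed auto

lemma abs_le_of_square_le: "x\<^sup>2 \<le> N \<Longrightarrow> - N \<le> x \<and> x \<le> N" for x :: int
  using abs_le_square[of x] by linarith

lemma odd_square_triples_subset: "odd_square_triples N \<subseteq> {-N..N} \<times> {-N..N} \<times> {-N..N}"
proof -
  have "- N \<le> x \<and> x \<le> N \<and> - N \<le> y \<and> y \<le> N \<and> - N \<le> z \<and> z \<le> N"
    if "x\<^sup>2 + y\<^sup>2 + z\<^sup>2 = N" for x y z
    using that abs_le_of_square_le[of x N] abs_le_of_square_le[of y N] abs_le_of_square_le[of z N]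
      zero_le_power2[of x] zero_le_power2[of y] zero_le_power2[of z] by linarith
  then show ?thesis by (auto simp: odd_square_triples_def)
qed

lemma odd_pair_product_triples_subset:
  "odd_pair_product_triples N \<subseteq> {1..N} \<times> {1..N} \<times> {1..N}"
proof -
  have "P \<le> N \<and> Q \<le> N \<and> R \<le> N"
    if "0 < P" "0 < Q" "0 < R" "P * Q + Q * R + R * P = N" for P Q R
  proof -
    have "P * 1 \<le> P * Q" "Q * 1 \<le> Q * R" "R * 1 \<le> R * P"
      using that by (intro mult_left_mono; simp)+
    then show ?thesis using that by linarith
  qed
  then show ?thesis by (auto simp: odd_pair_product_triples_def)
qed

lemma finite_odd_square_triples: "finite (odd_square_triples N)"
  by (rule finite_subset[OF odd_square_triples_subset]) auto

lemma finite_odd_pair_product_triples: "finite (odd_pair_product_triples N)"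
  by (rule finite_subset[OF odd_pair_product_triples_subset]) auto

text \<open>The range of \<open>t\<close> in the recursions below; the bound only keeps the set finite, since no
triples exist unless \<open>t\<^sup>2 < M\<close>.\<close>
definition odd_roots :: "int \<Rightarrow> int set" where
  "odd_roots M = {t. odd t \<and> \<bar>t\<bar> \<le> M}"

lemma finite_odd_roots: "finite (odd_roots M)"
proof -
  have "odd_roots M \<subseteq> {-M..M}" by (auto simp: odd_roots_def)
  then show ?thesis by (rule finite_subset) auto
qed

text \<open>The identity expresses that \<open>F = \<theta>\<^sup>3\<close>, with \<open>\<theta>\<close> the sum of \<open>q\<close> to the odd squares, solves
\<open>\<theta> \<cdot> F' = 3 \<cdot> \<theta>' \<cdot> F\<close>, the derivative being \<open>q d/dq\<close>. The sum runs over quadruples of odd numbers whose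
squares add up to \<open>M\<close>; by symmetry \<open>4 t\<^sup>2\<close> may be replaced by the sum of the four squares.\<close>
lemma odd_square_triples_recursion:
  "(\<Sum>t \<in> odd_roots M. (M - 4 * t\<^sup>2) * int (card (odd_square_triples (M - t\<^sup>2)))) = 0"
proof -
  define A where "A = (SIGMA t : odd_roots M. odd_square_triples (M - t\<^sup>2))"
  have A: "(t, x, y, z) \<in> A \<longleftrightarrow> odd t \<and> odd x \<and> odd y \<and> odd z \<and> t\<^sup>2 + x\<^sup>2 + y\<^sup>2 + z\<^sup>2 = M" for t x y z
  proof -
    have "\<bar>t\<bar> \<le> M" if "t\<^sup>2 + x\<^sup>2 + y\<^sup>2 + z\<^sup>2 = M"
      using that abs_le_square[of t] zero_le_power2[of x] zero_le_power2[of y] zero_le_power2[of z]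
      by linarith
    then show ?thesis by (auto simp: A_def odd_roots_def odd_square_triples_def)
  qed
  have [simp]: "finite A" by (simp add: A_def finite_odd_roots finite_odd_square_triples)
  define T where "T = (\<lambda>(t :: int, x :: int, y :: int, z :: int). (x, y, z, t))"
  have rot: "sum g A = (\<Sum>v \<in> A. g (T v))" for g :: "_ \<Rightarrow> int"
    by (rule sum.reindex_bij_witness[of _ T "\<lambda>(x, y, z, t). (t, x, y, z)"]) (auto simp: A T_def)
  define f where "f = (\<lambda>(t :: int, x :: int, y :: int, z :: int). t\<^sup>2)"
  have "(\<Sum>v \<in> A. M - 4 * f v) =
      (\<Sum>v \<in> A. f v + f (T v) + f (T (T v)) + f (T (T (T v))) - 4 * f v)"
    by (rule sum.cong) (auto simp: A f_def T_def)
  also have "\<dots> = (\<Sum>v\<in>A. f v) + (\<Sum>v\<in>A. f (T v)) + (\<Sum>v\<in>A. f (T (T v)))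
      + (\<Sum>v\<in>A. f (T (T (T v)))) - 4 * (\<Sum>v\<in>A. f v)"
    by (simp only: sum.distrib sum_subtractf sum_distrib_left)
  also have "\<dots> = 0"
    using rot[of f] rot[of "\<lambda>v. f (T v)"] rot[of "\<lambda>v. f (T (T v))"] by simp
  finally have "(\<Sum>(t, v) \<in> A. M - 4 * t\<^sup>2) = 0"
    by (simp add: f_def case_prod_unfold)
  then show ?thesis
    unfolding A_def by (subst (asm) sum.Sigma[symmetric]) (auto simp: finite_odd_roots finite_odd_square_triples mult.commute)
qed

text \<open>The equation \<open>t\<^sup>2 + P Q + Q R + R P = M\<close> after the substitution \<open>P = s + e\<close>, \<open>Q = s - e\<close>, \<open>R = r\<close>,
\<open>t = p - e\<close>. In these coordinates it is symmetric under exchanging \<open>(p, e)\<close> with \<open>(s, - r)\<close>.\<close>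
definition pair_quadruples :: "int \<Rightarrow> (int \<times> int \<times> int \<times> int) set" where
  "pair_quadruples M = {(p, e, s, r). odd p \<and> even e \<and> odd s \<and> odd r \<and> 0 < r \<and> \<bar>e\<bar> < s
     \<and> p\<^sup>2 + s\<^sup>2 + 2 * (s * r - p * e) = M}"

text \<open>An odd \<open>r\<close> is never an even multiple of the odd \<open>p\<close>, so it lies strictly within \<open>p\<close> of exactly one
odd multiple of \<open>p\<close>. This and the next lemma name its multiplier explicitly.\<close>
lemma odd_multiple_near:
  fixes p r i :: int
  assumes "odd i" and "\<bar>i * p - r\<bar> < p"
  shows "2 * (r div (2 * p)) + 1 = i"
proof -
  obtain j where j: "i = 2 * j + 1" using assms(1) by (auto elim: oddE)
  have "r div (2 * p) = j"
  proof (rule int_div_pos_eq)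
    show "r = 2 * p * j + (r - 2 * p * j)" by simp
  qed (use assms(2) in \<open>auto simp: j algebra_simps abs_if split: if_splits\<close>)
  then show ?thesis by (simp add: j)
qed

lemma odd_multiple_near_exists:
  fixes p r :: int
  assumes "odd p" "odd r" "0 < p"
  defines "i \<equiv> 2 * (r div (2 * p)) + 1"
  shows "\<bar>i * p - r\<bar> < p"
proof -
  define j where "j = r div (2 * p)"
  define m where "m = r mod (2 * p)"
  have m: "r = 2 * p * j + m" "0 \<le> m" "m < 2 * p"
    using assms by (auto simp: j_def m_def)
  have "odd m" using m(1) assms(2) by (metis dvd_triv_left even_add even_mult_iff)
  then have "m \<noteq> 0" by auto
  have "i * p - r = p - m" unfolding i_def j_def[symmetric] using m(1) by (simp add: algebra_simps)
  then show ?thesis using m \<open>m \<noteq> 0\<close> by auto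
qed

text \<open>The exchange \<open>(p, e, s, r) \<mapsto> (s, - r, p, - e)\<close> keeps the equation and negates the weight, but
leaves the region \<open>\<bar>e\<bar> < s\<close>, \<open>0 < r\<close> and interchanges the parities of \<open>e\<close> and \<open>r\<close>. For odd \<open>i\<close>, adding \<open>i\<close> times
the new \<open>s\<close> to the new \<open>e\<close>, and \<open>i\<close> times the new \<open>p\<close> to the new \<open>r\<close>, does not change \<open>s r - p e\<close> and repairs the
parities. For exactly one odd \<open>i\<close> it also restores \<open>\<bar>e\<bar> < s\<close>; this \<open>i\<close> is positive, which
restores \<open>0 < r\<close>, and the image has the same \<open>i\<close>, so the corrected exchange is an involution.\<close>
lemma sum_positive_pair_quadruples:
  "(\<Sum>(p, e, s, r) \<in> {v \<in> pair_quadruples M. 0 < fst v}. s\<^sup>2 - p\<^sup>2) = 0"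
proof (rule sum_eq_0_by_sign_reversing)
  define c where "c p r = 2 * (r div (2 * p)) + 1" for p r :: int
  define T where "T = (\<lambda>(p :: int, e :: int, s :: int, r :: int).
      (s, c p r * p - r, p, c p r * s - e))"
  let ?A = "{v \<in> pair_quadruples M. 0 < fst v}"
  fix v assume v: "v \<in> ?A"
  obtain p e s r where v_eq: "v = (p, e, s, r)" by (cases v)
  from v have h: "odd p" "even e" "odd s" "odd r" "0 < r" "\<bar>e\<bar> < s" "0 < p"
    and eq: "p\<^sup>2 + s\<^sup>2 + 2 * (s * r - p * e) = M" by (auto simp: v_eq pair_quadruples_def)
  define i where "i = c p r"
  have "odd i" by (simp add: i_def c_def)
  have near: "\<bar>i * p - r\<bar> < p"
    unfolding i_def c_def by (rule odd_multiple_near_exists) (use h in auto)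
  have "0 \<le> r div (2 * p)" using h by (simp add: pos_imp_zdiv_nonneg_iff)
  then have "1 \<le> i" by (simp add: i_def c_def)
  then have "1 * s \<le> i * s" using h by (intro mult_right_mono) auto
  then have r': "0 < i * s - e" using h by linarith
  have i': "c s (i * s - e) = i"
    unfolding c_def by (rule odd_multiple_near) (use h \<open>odd i\<close> in auto)
  have Tv: "T v = (s, i * p - r, p, i * s - e)" by (simp add: v_eq T_def i_def)
  show "T v \<in> ?A"
    using h near r' \<open>odd i\<close> eq by (auto simp: Tv pair_quadruples_def algebra_simps)
  show "T (T v) = v"
    unfolding Tv by (simp add: v_eq T_def i')
  show "(case T v of (p, e, s, r) \<Rightarrow> s\<^sup>2 - p\<^sup>2) = - (case v of (p, e, s, r) \<Rightarrow> s\<^sup>2 - p\<^sup>2)"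
    unfolding Tv by (simp add: v_eq)
qed

lemma sum_pair_quadruples:
  assumes "finite (pair_quadruples M)"
  shows "(\<Sum>(p, e, s, r) \<in> pair_quadruples M. s\<^sup>2 - p\<^sup>2) = 0"
proof -
  let ?g = "\<lambda>(p :: int, e :: int, s :: int, r :: int). s\<^sup>2 - p\<^sup>2"
  let ?A = "{v \<in> pair_quadruples M. 0 < fst v}"
  let ?B = "{v \<in> pair_quadruples M. fst v < 0}"
  have "fst v \<noteq> 0" if "v \<in> pair_quadruples M" for v
    using that by (auto simp: pair_quadruples_def)
  then have "pair_quadruples M = ?A \<union> ?B" by (auto simp: neq_iff)
  then have "sum ?g (pair_quadruples M) = sum ?g (?A \<union> ?B)" by simp
  also have "\<dots> = sum ?g ?A + sum ?g ?B"
    by (rule sum.union_disjoint) (use assms in \<open>auto intro: rev_finite_subset\<close>)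
  also have "sum ?g ?B = sum ?g ?A"
    by (rule sum.reindex_bij_witness[of _ "\<lambda>(p, e, s, r). (- p, - e, s, r)"
          "\<lambda>(p, e, s, r). (- p, - e, s, r)"]) (auto simp: pair_quadruples_def)
  finally show ?thesis using sum_positive_pair_quadruples[of M] by simp
qed

text \<open>This is the recursion of the odd square triples. By the cyclic symmetry of \<open>P, Q, R\<close> the weight
\<open>M - 4 t\<^sup>2\<close> may be replaced by \<open>3 (P Q - t\<^sup>2)\<close>, and
\<open>P Q - t\<^sup>2 = s\<^sup>2 - p\<^sup>2 + 2 e t\<close> in the coordinates of the pair quadruples. The last term cancels under
\<open>t \<mapsto> - t\<close>, the rest by the involution above. The condition on \<open>M\<close> makes \<open>P - Q\<close> divisible by \<open>4\<close>.\<close>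
lemma odd_pair_product_triples_recursion:
  assumes M: "M mod 8 = 4"
  shows "(\<Sum>t \<in> odd_roots M. (M - 4 * t\<^sup>2) * int (card (odd_pair_product_triples (M - t\<^sup>2)))) = 0"
proof -
  define A where "A = (SIGMA t : odd_roots M. odd_pair_product_triples (M - t\<^sup>2))"
  have A: "(t, P, Q, R) \<in> A \<longleftrightarrow> odd t \<and> odd P \<and> odd Q \<and> odd R \<and> 0 < P \<and> 0 < Q \<and> 0 < R
      \<and> t\<^sup>2 + P * Q + Q * R + R * P = M" for t P Q R
  proof -
    have "\<bar>t\<bar> \<le> M" if "t\<^sup>2 + P * Q + Q * R + R * P = M" "0 < P" "0 < Q" "0 < R"
      using that abs_le_square[of t] mult_pos_pos[of P Q] mult_pos_pos[of Q R] mult_pos_pos[of R P]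
      by linarith
    then show ?thesis by (auto simp: A_def odd_roots_def odd_pair_product_triples_def)
  qed
  have [simp]: "finite A" by (simp add: A_def finite_odd_roots finite_odd_pair_product_triples)
  define T where "T = (\<lambda>(t :: int, P :: int, Q :: int, R :: int). (t, Q, R, P))"
  have rot: "sum g A = (\<Sum>v \<in> A. g (T v))" for g :: "_ \<Rightarrow> int"
    by (rule sum.reindex_bij_witness[of _ T "\<lambda>(t, Q, R, P). (t, P, Q, R)"]) (auto simp: A T_def)
  define f where "f = (\<lambda>(t :: int, P :: int, Q :: int, R :: int). P * Q - t\<^sup>2)"
  have mod4: "4 dvd P - Q" if "(t, P, Q, R) \<in> A" for t P Q R
  proof -
    have o: "odd t" "odd P" "odd Q" "odd R" and eq: "t\<^sup>2 + P * Q + Q * R + R * P = M"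
      using that by (auto simp: A)
    obtain a b c u where ab: "t = 2 * u + 1" "P = 2 * a + 1" "Q = 2 * b + 1" "R = 2 * c + 1"
      using o by (meson oddE)
    have "M = 4 * (u * u + u + a * b + b * c + c * a + a + b + c + 1)"
      using eq by (simp add: ab power2_eq_square algebra_simps)
    moreover obtain q where "M = 8 * q + 4" using M by (metis div_mult_mod_eq mult.commute)
    moreover have "even (u * u + u)" by simp
    ultimately have "(u * u + u) + (a * b + b * c + c * a + a + b + c) = 2 * q" by simp
    then have "even ((u * u + u) + (a * b + b * c + c * a + a + b + c))" by (rule dvdI)
    then have "even (a * b + b * c + c * a + a + b + c)"
      using \<open>even (u * u + u)\<close> by (simp only: even_add)
    then have "even (a - b)" by (cases "even a"; cases "even b"; cases "even c"; simp)
    then obtain k where "a - b = 2 * k" by (rule evenE)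
    then have "P - Q = 4 * k" by (simp add: ab)
    then show ?thesis by (rule dvdI)
  qed
  have key: "(\<Sum>v \<in> A. f v) = 0"
  proof -
    define to where "to = (\<lambda>(t :: int, P :: int, Q :: int, R :: int).
        (t + (P - Q) div 2, (P - Q) div 2, (P + Q) div 2, R))"
    define fro where "fro = (\<lambda>(p :: int, e :: int, s :: int, r :: int). (p - e, s + e, s - e, r))"
    have half: "\<exists>e s. even e \<and> odd s \<and> P = s + e \<and> Q = s - e"
      if "(t, P, Q, R) \<in> A" for t P Q R
    proof -
      obtain k where "P - Q = 4 * k" using mod4[OF \<open>(t, P, Q, R) \<in> A\<close>] by (auto elim: dvdE)
      moreover have "odd Q" using that by (auto simp: A)
      ultimately show ?thesis by (intro exI[of _ "2 * k"] exI[of _ "Q + 2 * k"]) auto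
    qed
    have to: "to v \<in> pair_quadruples M \<and> fro (to v) = v" if "v \<in> A" for v
    proof -
      obtain t P Q R where v: "v = (t, P, Q, R)" by (cases v)
      obtain e s where es: "even e" "odd s" "P = s + e" "Q = s - e"
        using half[of t P Q R] \<open>v \<in> A\<close> by (auto simp: v)
      have "to v = (t + e, e, s, R)" by (simp add: to_def v es)
      moreover have "(t + e)\<^sup>2 + s\<^sup>2 + 2 * (s * R - (t + e) * e) = M" "\<bar>e\<bar> < s"
        using that by (auto simp: v A es power2_eq_square algebra_simps abs_if)
      ultimately show ?thesis
        using that es by (auto simp: pair_quadruples_def v A fro_def)
    qed
    have fro: "fro v \<in> A \<and> to (fro v) = v" if "v \<in> pair_quadruples M" for v
    proof -
      obtain p e s r where v: "v = (p, e, s, r)" by (cases v)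
      show ?thesis using that
        by (auto simp: v A fro_def to_def pair_quadruples_def power2_eq_square algebra_simps)
    qed
    have fin: "finite (pair_quadruples M)"
      by (rule finite_surj[of A _ to]) (use fro in \<open>force+\<close>)
    have "(\<Sum>v \<in> A. f v) = (\<Sum>v \<in> A. (case to v of (p, e, s, r) \<Rightarrow> s\<^sup>2 - p\<^sup>2)
        + (case v of (t, P, Q, R) \<Rightarrow> t * (P - Q)))"
    proof (rule sum.cong)
      fix v assume "v \<in> A"
      obtain t P Q R where v: "v = (t, P, Q, R)" by (cases v)
      obtain e s where es: "even e" "odd s" "P = s + e" "Q = s - e"
        using half[of t P Q R] \<open>v \<in> A\<close> by (auto simp: v)
      show "f v = (case to v of (p, e, s, r) \<Rightarrow> s\<^sup>2 - p\<^sup>2)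
          + (case v of (t, P, Q, R) \<Rightarrow> t * (P - Q))"
        by (simp add: v f_def to_def es power2_eq_square algebra_simps)
    qed simp
    also have "\<dots> = (\<Sum>v \<in> A. case to v of (p, e, s, r) \<Rightarrow> s\<^sup>2 - p\<^sup>2)
        + (\<Sum>(t, P, Q, R) \<in> A. t * (P - Q))" by (rule sum.distrib)
    also have "(\<Sum>v \<in> A. case to v of (p, e, s, r) \<Rightarrow> s\<^sup>2 - p\<^sup>2)
        = (\<Sum>(p, e, s, r) \<in> pair_quadruples M. s\<^sup>2 - p\<^sup>2)"
      by (rule sum.reindex_bij_witness[of _ fro to]) (use to fro in auto)
    also have "\<dots> = 0" by (rule sum_pair_quadruples[OF fin])
    also have "(\<Sum>(t, P, Q, R) \<in> A. t * (P - Q)) = 0"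
      by (rule sum_eq_0_by_sign_reversing[of _ "\<lambda>(t, P, Q, R). (- t, P, Q, R)"])
        (auto simp: A)
    finally show ?thesis by simp
  qed
  have "(\<Sum>(t, v) \<in> A. M - 4 * t\<^sup>2) = (\<Sum>v \<in> A. f v + f (T v) + f (T (T v)))"
    by (rule sum.cong) (auto simp: A f_def T_def)
  also have "\<dots> = 0"
    using key rot[of f] rot[of "\<lambda>v. f (T v)"] by (simp add: sum.distrib)
  finally show ?thesis
    unfolding A_def by (subst (asm) sum.Sigma[symmetric]) (auto simp: finite_odd_roots finite_odd_pair_product_triples mult.commute)
qed

lemma odd_square_mod_8: "odd x \<Longrightarrow> x\<^sup>2 mod 8 = 1" for x :: int
proof -
  assume "odd x"
  then obtain k where k: "x = 2 * k + 1" by (auto elim: oddE)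
  have "even (k * (k + 1))" by simp
  then obtain j where "k * (k + 1) = 2 * j" by (rule evenE)
  then have "x\<^sup>2 = 8 * j + 1" by (simp add: k power2_eq_square algebra_simps)
  then show ?thesis by simp
qed

text \<open>With \<open>M = N + 1\<close>, the terms \<open>t = 1\<close> and \<open>t = - 1\<close> of the recursion determine the value at \<open>N\<close> from the
values at smaller arguments, as their coefficient \<open>M - 4\<close> vanishes only for \<open>N = 3\<close>. So the recursion
has, up to scaling, one solution. The factor \<open>8\<close> counts the signs of \<open>x, y, z\<close>.\<close>
lemma card_odd_square_triples:
  "N mod 8 = 3 \<Longrightarrow>
     int (card (odd_square_triples N)) = 8 * int (card (odd_pair_product_triples N))"
proof (induction "nat N" arbitrary: N rule: less_induct)
  case (less N)
  define D where
    "D N = int (card (odd_square_triples N)) - 8 * int (card (odd_pair_product_triples N))" for N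
  have empty: "D K = 0" if "K \<le> 0" for K
  proof -
    have "odd_square_triples K = {}"
    proof -
      have "x\<^sup>2 + y\<^sup>2 + z\<^sup>2 \<noteq> K" if "odd x" for x y z :: int
      proof -
        have "x \<noteq> 0" using that by auto
        then have "0 < x\<^sup>2" by simp
        then show ?thesis
          using \<open>K \<le> 0\<close> zero_le_power2[of y] zero_le_power2[of z] by linarith
      qed
      then show ?thesis by (auto simp: odd_square_triples_def)
    qed
    moreover have "odd_pair_product_triples K = {}"
      using that odd_pair_product_triples_subset[of K] by auto
    ultimately show ?thesis by (simp add: D_def)
  qed
  have "D N = 0"
  proof -
    have "\<not> (0 < N \<and> N < 3)" using less.prems by auto
    then consider "N \<le> 0" | "N = 3" | "N > 3" by linarith
    then show ?thesis
    proof cases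
      case 1
      then show ?thesis by (rule empty)
    next
      case 2
      have unit: "x \<in> {-1, 1}" if "odd x" "x\<^sup>2 \<le> 3" for x :: int
      proof -
        have "\<bar>x\<bar> < 2" using that(2) by (intro power2_less_imp_less[of "\<bar>x\<bar>" 2]) auto
        then have "x = -1 \<or> x = 0 \<or> x = 1" by linarith
        then show ?thesis using that(1) by auto
      qed
      have "x \<in> {-1, 1} \<and> y \<in> {-1, 1} \<and> z \<in> {-1, 1}"
        if "odd x" "odd y" "odd z" "x\<^sup>2 + y\<^sup>2 + z\<^sup>2 = 3" for x y z :: int
      proof -
        have "x\<^sup>2 \<le> 3" "y\<^sup>2 \<le> 3" "z\<^sup>2 \<le> 3"
          using that(4) zero_le_power2[of x] zero_le_power2[of y] zero_le_power2[of z] by linarith+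
        then show ?thesis using unit that(1-3) by blast
      qed
      then have "odd_square_triples 3 \<subseteq> {-1, 1} \<times> {-1, 1} \<times> {-1, 1}"
        unfolding odd_square_triples_def by blast
      moreover have "{-1, 1} \<times> {-1, 1} \<times> {-1, 1} \<subseteq> odd_square_triples 3"
        by (simp add: odd_square_triples_def)
      ultimately have "odd_square_triples 3 = {-1, 1} \<times> {-1, 1} \<times> {-1, 1}" by (rule equalityI)
      moreover have "odd_pair_product_triples 3 = {(1, 1, 1)}"
      proof -
        have "P = 1 \<and> Q = 1 \<and> R = 1"
          if "0 < P" "0 < Q" "0 < R" "P * Q + Q * R + R * P = 3" for P Q R :: int
        proof -
          have "P * 1 \<le> P * Q" "Q * 1 \<le> Q * R" "R * 1 \<le> R * P"
            using that by (intro mult_left_mono; simp)+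
          then show ?thesis using that by linarith
        qed
        then show ?thesis by (auto simp: odd_pair_product_triples_def)
      qed
      ultimately show ?thesis by (simp add: 2 D_def card_cartesian_product)
    next
      case 3
      define M where "M = N + 1"
      have M: "M mod 8 = 4"
        using mod_add_left_eq[of N 8 1] less.prems by (simp add: M_def)
      have "(\<Sum>t \<in> odd_roots M. (M - 4 * t\<^sup>2) * D (M - t\<^sup>2)) = 0"
        using odd_square_triples_recursion[of M] odd_pair_product_triples_recursion[OF M]
        by (simp add: D_def right_diff_distrib sum_subtractf mult.left_commute[of _ 8]
            flip: sum_distrib_left)
      also have "(\<Sum>t \<in> odd_roots M. (M - 4 * t\<^sup>2) * D (M - t\<^sup>2))
          = (\<Sum>t \<in> {-1, 1}. (M - 4 * t\<^sup>2) * D (M - t\<^sup>2))"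
      proof (rule sum.mono_neutral_right)
        show "{-1, 1} \<subseteq> odd_roots M" using 3 by (auto simp: odd_roots_def M_def)
        show "\<forall>t \<in> odd_roots M - {-1, 1}. (M - 4 * t\<^sup>2) * D (M - t\<^sup>2) = 0"
        proof
          fix t assume t: "t \<in> odd_roots M - {-1, 1}"
          then have "odd t" "t \<noteq> 1" "t \<noteq> -1" by (auto simp: odd_roots_def)
          then have "1 < \<bar>t\<bar>" by (cases "t = 0") auto
          then have t2: "1 < t\<^sup>2" using abs_le_square[of t] by linarith
          have "(M - t\<^sup>2) mod 8 = 3"
            using mod_diff_eq[of M 8 "t\<^sup>2"] M odd_square_mod_8[OF \<open>odd t\<close>] by simp
          then have "D (M - t\<^sup>2) = 0"
            using less.hyps[of "M - t\<^sup>2"] t2 3 empty[of "M - t\<^sup>2"]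
            by (cases "M - t\<^sup>2 \<le> 0") (auto simp: D_def M_def)
          then show "(M - 4 * t\<^sup>2) * D (M - t\<^sup>2) = 0" by simp
        qed
      qed (simp add: finite_odd_roots)
      finally show ?thesis using 3 by (auto simp: M_def)
    qed
  qed
  then show ?case by (simp add: D_def)
qed

text \<open>Gauss's theorem on three triangular numbers, which is the representation of \<open>8 n + 3\<close> by three
odd squares. The numbers \<open>x (2 x - 1)\<close> with integral \<open>x\<close> are exactly the triangular numbers, and this
form has the advantage of being the energy of a 2-core.\<close>
lemma sum_of_three_hexagonal:
  fixes n :: nat
  obtains x y z :: int where "int n = x * (2 * x - 1) + y * (2 * y - 1) + z * (2 * z - 1)"
proof -
  define N where "N = 8 * int n + 3"
  have "(1, 1, 4 * int n + 1) \<in> odd_pair_product_triples N"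
    by (auto simp: odd_pair_product_triples_def N_def)
  then have "card (odd_pair_product_triples N) \<noteq> 0" by (auto simp: finite_odd_pair_product_triples)
  moreover have "N mod 8 = 3" by (simp add: N_def)
  ultimately have "card (odd_square_triples N) \<noteq> 0"
    using card_odd_square_triples by fastforce
  then obtain a b c where abc: "odd a" "odd b" "odd c" "a\<^sup>2 + b\<^sup>2 + c\<^sup>2 = N"
    by (auto simp: odd_square_triples_def card_eq_0_iff)
  \<comment> \<open>Up to its sign an odd number is congruent to \<open>3\<close> modulo \<open>4\<close>.\<close>
  have root: "\<exists>x. a\<^sup>2 = 8 * (x * (2 * x - 1)) + 1" if "odd a" for a :: int
  proof -
    have "4 dvd a + 1 \<or> 4 dvd - a + 1" using that by presburger
    then obtain x where "a + 1 = 4 * x \<or> - a + 1 = 4 * x" by (auto elim!: dvdE)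
    then have "a\<^sup>2 = (4 * x - 1)\<^sup>2" by (auto simp: power2_eq_iff)
    then show ?thesis by (intro exI[of _ x]) (simp add: power2_eq_square algebra_simps)
  qed
  obtain x y z where "a\<^sup>2 = 8 * (x * (2 * x - 1)) + 1" "b\<^sup>2 = 8 * (y * (2 * y - 1)) + 1"
    "c\<^sup>2 = 8 * (z * (2 * z - 1)) + 1" using root abc by metis
  then show ?thesis using abc(4) by (intro that[of x y z]) (simp add: N_def)
qed

section \<open>Representing every energy\<close>

lemma realizable_more_components:
  assumes "realizable l d s n" "l \<le> l'"
  shows "realizable l' d s n"
proof -
  obtain Y where Y: "\<And>a. a < l \<Longrightarrow> maya (Y a)" "\<And>a. a < l \<Longrightarrow> closed_under d (Y a)"
    "(\<Sum>a<l. charge (Y a)) = s" "(\<Sum>a<l. energy (Y a)) = n"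
    using assms(1) by (auto simp: realizable_def)
  define Z where "Z a = (if a < l then Y a else {..0})" for a
  have dev: "deviation {..0} = {}" by (auto simp: deviation_def)
  have "(\<Sum>a<l'. excess w (Z a)) = (\<Sum>a<l. excess w (Y a))" for w
    by (rule sum.mono_neutral_cong_right) (use assms(2) in \<open>auto simp: Z_def excess_def dev\<close>)
  moreover have "maya (Z a)" "closed_under d (Z a)" for a
    using Y by (auto simp: Z_def dev closed_under_def)
  ultimately show ?thesis unfolding realizable_def using Y by (intro exI[of _ Z]) auto
qed

lemma realizable_multiple_step:
  assumes "realizable l d s n" "d dvd d'"
  shows "realizable l d' s n"
proof -
  obtain k where k: "d' = d * k" using assms(2) by auto
  have "closed_under d' Y" if Y: "closed_under d Y" for Y
  proof -
    have "b - int (d * k) \<in> Y" if "b \<in> Y" for b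
    proof (induction k)
      case (Suc k)
      then have "b - int (d * k) - int d \<in> Y" using Y unfolding closed_under_def by blast
      then show ?case by (simp add: algebra_simps)
    qed (use that in simp)
    then show ?thesis by (simp add: closed_under_def k)
  qed
  then show ?thesis using assms(1) unfolding realizable_def by blast
qed

text \<open>Staircase partitions are 2-cores and have triangular numbers as sizes, so three of them suffice. On two runners
the charges \<open>x, - x\<close> give the energy \<open>x (2 x - 1)\<close>; so do the charges \<open>1 - x, x\<close>, with total charge \<open>1\<close>.\<close>
lemma realizable_even:
  assumes "even d" "s = 0 \<or> s = 1"
  shows "realizable 3 d s (int n)"
proof (rule realizable_multiple_step)
  obtain x y z where n: "int n = x * (2 * x - 1) + y * (2 * y - 1) + z * (2 * z - 1)"
    by (rule sum_of_three_hexagonal)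
  show "realizable 3 2 s (int n)"
    by (rule realizable_abacus[where
          N = "\<lambda>a r. [[if s = 0 then x else 1 - x, if s = 0 then - x else x], [y, - y], [z, - z]] ! a ! r"])
      (use assms(2) in \<open>auto simp: numeral_2_eq_2 numeral_3_eq_3 twice_runner_energy_def n algebra_simps\<close>)
qed (use assms in simp)

text \<open>With \<open>\<alpha> = 1 - 4 x\<close>, \<open>\<beta> = 1 - 4 y\<close>, \<open>\<gamma> = 1 - 4 z\<close> and \<open>\<alpha>\<^sup>2 + \<beta>\<^sup>2 + \<gamma>\<^sup>2 = 8 n + 3\<close>, the charges are
\<open>(1 + \<alpha> + \<beta> + \<gamma>) / 4\<close> and the three numbers obtained by negating two of \<open>\<alpha>, \<beta>, \<gamma>\<close>. This map is orthogonal up to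
scaling, which gives the sum of their squares.\<close>
lemma charges_of_four_components:
  obtains N :: "nat \<Rightarrow> int" where "(\<Sum>a<4. N a) = 1"
    "(\<Sum>a<4. twice_runner_energy 1 0 (N a)) = 2 * int n"
proof -
  obtain x y z where n: "int n = x * (2 * x - 1) + y * (2 * y - 1) + z * (2 * z - 1)"
    by (rule sum_of_three_hexagonal)
  show ?thesis
    by (rule that[of "\<lambda>a. [1 - x - y - z, y + z - x, x + z - y, x + y - z] ! a"])
      (simp_all add: eval_nat_numeral twice_runner_energy_def n algebra_simps)
qed

text \<open>For total charge \<open>0\<close> a fifth component of charge \<open>- 1\<close> and energy \<open>1\<close> balances the other four.\<close>
lemma realizable_unit:
  assumes "s = 1 \<and> 4 \<le> l \<or> s = 0 \<and> 5 \<le> l"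
  shows "realizable l 1 s (int n)"
  using assms
proof
  assume *: "s = 1 \<and> 4 \<le> l"
  obtain N :: "nat \<Rightarrow> int" where "(\<Sum>a<4. N a) = 1"
    "(\<Sum>a<4. twice_runner_energy 1 0 (N a)) = 2 * int n" by (rule charges_of_four_components)
  then have "realizable 4 1 1 (int n)"
    by (intro realizable_abacus[where N = "\<lambda>a _. N a"]) auto
  then show ?thesis using * realizable_more_components by blast
next
  assume *: "s = 0 \<and> 5 \<le> l"
  have "realizable 5 1 0 (int n)"
  proof (cases n)
    case 0
    then show ?thesis by (intro realizable_abacus[where N = "\<lambda>_ _. 0"]) auto
  next
    case (Suc k)
    obtain N :: "nat \<Rightarrow> int" where N: "(\<Sum>a<4. N a) = 1"
      "(\<Sum>a<4. twice_runner_energy 1 0 (N a)) = 2 * int k" by (rule charges_of_four_components)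
    have five: "{..<5 :: nat} = insert 4 {..<4}" by auto
    show ?thesis
      by (rule realizable_abacus[where N = "\<lambda>a _. if a = 4 then -1 else N a"])
        (use N in \<open>auto simp: five Suc twice_runner_energy_def\<close>)
  qed
  then show ?thesis using * realizable_more_components by blast
qed

lemma square_mod_3: "x\<^sup>2 mod 3 = (if x mod 3 = 0 then 0 else 1)" for x :: int
proof -
  have "x\<^sup>2 mod 3 = (x mod 3)\<^sup>2 mod 3" by (simp add: power_mod)
  moreover have "x mod 3 = 0 \<or> x mod 3 = 1 \<or> x mod 3 = 2"
    using pos_mod_bound[of 3 x] pos_mod_sign[of 3 x] by linarith
  ultimately show ?thesis by (elim disjE) simp_all
qed

lemma mod_3_sum4:
  "(a + b + c + e) mod 3 = (a mod 3 + b mod 3 + c mod 3 + e mod 3) mod 3" for a b c e :: int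
  by (intro mod_add_cong) simp_all

lemma residues_of_three:
  fixes a b c :: int
  assumes "a \<in> {0, 1, 2}" "b \<in> {0, 1, 2}" "c \<in> {0, 1, 2}" and "(a + b + c) mod 3 = 2"
    and "((if a = 0 then 0 else 1) + (if b = 0 then 0 else 1) + (if c = 0 then 0 else 1) :: int) mod 3 = 0"
  shows "a = 1 \<and> b = 2 \<and> c = 2 \<or> a = 2 \<and> b = 1 \<and> c = 2 \<or> a = 2 \<and> b = 2 \<and> c = 1"
  using assms by (elim insertE emptyE) simp_all

text \<open>The sum of squares forces the number of terms divisible by \<open>3\<close> to be one or four, and the sum excludes
four; then it also fixes the residues of the other three.\<close>
lemma arrange_residues_mod_3:
  fixes u0 u1 u2 u3 :: int
  assumes "(u0 + u1 + u2 + u3) mod 3 = 2" "(u0\<^sup>2 + u1\<^sup>2 + u2\<^sup>2 + u3\<^sup>2) mod 3 = 0"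
  obtains a b c e where "u0 + u1 + u2 + u3 = 3 * a + (3 * b + 1) + (3 * c + 2) + (3 * e + 2)"
    "u0\<^sup>2 + u1\<^sup>2 + u2\<^sup>2 + u3\<^sup>2 = (3 * a)\<^sup>2 + (3 * b + 1)\<^sup>2 + (3 * c + 2)\<^sup>2 + (3 * e + 2)\<^sup>2"
proof -
  note goal = that
  have thesis1: thesis if "v0 mod 3 = 0" "v1 mod 3 = 1" "v2 mod 3 = 2" "v3 mod 3 = 2"
    "v0 + v1 + v2 + v3 = u0 + u1 + u2 + u3"
    "v0\<^sup>2 + v1\<^sup>2 + v2\<^sup>2 + v3\<^sup>2 = u0\<^sup>2 + u1\<^sup>2 + u2\<^sup>2 + u3\<^sup>2" for v0 v1 v2 v3
  proof -
    note div = mult_div_mod_eq[of 3 v0, unfolded that(1) add_0_right] mult_div_mod_eq[of 3 v1, unfolded that(2)]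
      mult_div_mod_eq[of 3 v2, unfolded that(3)] mult_div_mod_eq[of 3 v3, unfolded that(4)]
    show thesis
      by (rule goal[of "v0 div 3" "v1 div 3" "v2 div 3" "v3 div 3"]) (simp_all only: div that(5,6))
  qed
  have thesis2: thesis if "v0 mod 3 = 0"
    "v0 + v1 + v2 + v3 = u0 + u1 + u2 + u3"
    "v0\<^sup>2 + v1\<^sup>2 + v2\<^sup>2 + v3\<^sup>2 = u0\<^sup>2 + u1\<^sup>2 + u2\<^sup>2 + u3\<^sup>2" for v0 v1 v2 v3
  proof -
    have s: "(v0 + v1 + v2 + v3) mod 3 = 2" using assms(1) that(2) by simp
    have "(v0\<^sup>2 + v1\<^sup>2 + v2\<^sup>2 + v3\<^sup>2) mod 3 = 0" using assms(2) that(3) by simp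
    then have q: "(v0\<^sup>2 mod 3 + v1\<^sup>2 mod 3 + v2\<^sup>2 mod 3 + v3\<^sup>2 mod 3) mod 3 = 0"
      by (subst (asm) mod_3_sum4)
    have s': "(v1 mod 3 + v2 mod 3 + v3 mod 3) mod 3 = 2" 
      using s[unfolded mod_3_sum4[of v0 v1 v2 v3] that(1)] by (simp only: add_0)
    have m: "t mod 3 \<in> {0, 1, 2}" for t :: int
    proof -
      have "t mod 3 < 3" "0 \<le> t mod 3" by simp_all
      then have "t mod 3 = 0 \<or> t mod 3 = 1 \<or> t mod 3 = 2" by linarith
      then show ?thesis by (simp only: insert_iff empty_iff simp_thms)
    qed
    have "((if v1 mod 3 = 0 then 0 else 1) + (if v2 mod 3 = 0 then 0 else 1)
        + (if v3 mod 3 = 0 then 0 else 1) :: int) mod 3 = 0"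
      using q that(1) unfolding square_mod_3 by (simp only: simp_thms if_True add_0)
    from residues_of_three[OF m m m s' this]
    consider "v1 mod 3 = 1" "v2 mod 3 = 2" "v3 mod 3 = 2"
      | "v2 mod 3 = 1" "v1 mod 3 = 2" "v3 mod 3 = 2"
      | "v3 mod 3 = 1" "v2 mod 3 = 2" "v1 mod 3 = 2"
      by blast
    then show thesis
    proof cases
      case 1 then show thesis by (rule thesis1[OF that(1) _ _ _ that(2,3)])
    next
      case 2 show thesis
        by (rule thesis1[OF that(1) 2]) (use that(2,3) in \<open>simp_all only: ac_simps\<close>)
    next
      case 3 show thesis
        by (rule thesis1[OF that(1) 3]) (use that(2,3) in \<open>simp_all only: ac_simps\<close>)
    qed
  qed
  have "(u0\<^sup>2 mod 3 + u1\<^sup>2 mod 3 + u2\<^sup>2 mod 3 + u3\<^sup>2 mod 3) mod 3 = 0"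
    using assms(2) by (subst (asm) mod_3_sum4)
  then have "u0 mod 3 = 0 \<or> u1 mod 3 = 0 \<or> u2 mod 3 = 0 \<or> u3 mod 3 = 0"
  proof (rule contrapos_pp)
    assume "\<not> (u0 mod 3 = 0 \<or> u1 mod 3 = 0 \<or> u2 mod 3 = 0 \<or> u3 mod 3 = 0)"
    then show "(u0\<^sup>2 mod 3 + u1\<^sup>2 mod 3 + u2\<^sup>2 mod 3 + u3\<^sup>2 mod 3) mod 3 \<noteq> 0"
      unfolding square_mod_3 de_Morgan_disj by (simp only: if_False) simp
  qed
  then consider "u0 mod 3 = 0" | "u1 mod 3 = 0" | "u2 mod 3 = 0" | "u3 mod 3 = 0" by blast
  then show thesis
  proof cases
    case 1 then show thesis by (rule thesis2[of u0 u1 u2 u3]) simp_all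
  next
    case 2 then show thesis by (rule thesis2[of u1 u0 u2 u3]) simp_all
  next
    case 3 then show thesis by (rule thesis2[of u2 u1 u0 u3]) simp_all
  next
    case 4 then show thesis by (rule thesis2[of u3 u1 u2 u0]) simp_all
  qed
qed

text \<open>A runner \<open>r\<close> with charge \<open>N\<close> has its first gap at \<open>u = 3 N + r\<close>, and its energy is a quadratic polynomial in \<open>u\<close>
which depends on \<open>r\<close> only through its constant term. So four numbers \<open>u\<close> with sum \<open>5\<close> and sum of squares
\<open>6 n + 9\<close> are sought, whatever their residues modulo \<open>3\<close>: these come out as \<open>0, 1, 2, 2\<close>, and the three components
have enough runners of each kind. Such numbers arise from \<open>8 (3 n + 1) + 3\<close> as a sum of three odd squares by
the same orthogonal map as for four components with \<open>d = 1\<close>.\<close>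
lemma realizable_3_3:
  assumes "s = 0 \<or> s = 1"
  shows "realizable 3 3 s (int n)"
proof -
  obtain x y z where xyz: "int (3 * n + 1) = x * (2 * x - 1) + y * (2 * y - 1) + z * (2 * z - 1)"
    by (rule sum_of_three_hexagonal)
  let ?u0 = "2 - (x + y + z)" and ?u1 = "1 + y + z - x" and ?u2 = "1 + x + z - y"
    and ?u3 = "1 + x + y - z"
  have sum: "?u0 + ?u1 + ?u2 + ?u3 = 5" by simp
  have sq: "?u0\<^sup>2 + ?u1\<^sup>2 + ?u2\<^sup>2 + ?u3\<^sup>2 = 6 * int n + 9"
    using xyz by (simp add: power2_eq_square algebra_simps)
  have "(?u0 + ?u1 + ?u2 + ?u3) mod 3 = 2" unfolding sum by simp
  moreover have "(?u0\<^sup>2 + ?u1\<^sup>2 + ?u2\<^sup>2 + ?u3\<^sup>2) mod 3 = 0" unfolding sq by presburger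
  ultimately obtain a b c e where
    abce: "?u0 + ?u1 + ?u2 + ?u3 = 3 * a + (3 * b + 1) + (3 * c + 2) + (3 * e + 2)"
    "?u0\<^sup>2 + ?u1\<^sup>2 + ?u2\<^sup>2 + ?u3\<^sup>2 = (3 * a)\<^sup>2 + (3 * b + 1)\<^sup>2 + (3 * c + 2)\<^sup>2 + (3 * e + 2)\<^sup>2"
    by (rule arrange_residues_mod_3)
  have lin: "a + b + c + e = 0" using abce(1) unfolding sum by simp
  have "9 * (a * a + b * b + c * c + e * e) + 6 * b + 12 * c + 12 * e = 6 * int n"
    using abce(2) unfolding sq by (simp add: power2_eq_square algebra_simps)
  then have "3 * (a * a + b * b + c * c + e * e) + 2 * b + 4 * c + 4 * e = 2 * int n" by simp
  then show ?thesis using lin assms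
    by (intro realizable_abacus[where N = "\<lambda>i r. [[a, b, c], [s, 0, e], [0, 0, 0]] ! i ! r"])
      (auto simp: numeral_2_eq_2 numeral_3_eq_3 twice_runner_energy_def algebra_simps)
qed

lemma sum_fun_upd:
  fixes G :: "nat \<Rightarrow> int \<Rightarrow> int"
  assumes "r < d"
  shows "(\<Sum>i<d. G i ((f(r := v)) i)) = (\<Sum>i<d. G i (f i)) + (G r v - G r (f r))"
proof -
  have "(\<Sum>i<d. G i ((f(r := v)) i)) = G r v + (\<Sum>i\<in>{..<d} - {r}. G i ((f(r := v)) i))"
    using assms by (subst sum.remove[of _ r]) auto
  also have "(\<Sum>i\<in>{..<d} - {r}. G i ((f(r := v)) i)) = (\<Sum>i\<in>{..<d} - {r}. G i (f i))"
    by (rule sum.cong) auto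
  also have "\<dots> = (\<Sum>i<d. G i (f i)) - G r (f r)"
    using assms by (subst (2) sum.remove[of _ r]) auto
  finally show ?thesis by simp
qed

text \<open>Charge \<open>m\<close> on a pair of opposite runners \<open>\<rho>\<close> and \<open>d - \<rho>\<close> costs \<open>d m\<^sup>2\<close>, and the charges \<open>k + 1, k\<close> on \<open>r\<close> and
\<open>d - r\<close> cost \<open>d (k\<^sup>2 + k) + r\<close>. The latter reaches any nonzero residue of the energy modulo \<open>d\<close>. As \<open>d\<close> is odd
and at least \<open>5\<close>, two disjoint pairs and the runner \<open>0\<close> fit into one component.\<close>
lemma runners_with_odd_pair:
  assumes d: "odd d" "5 \<le> d" and r: "0 < r" "r < d"
  obtains f :: "nat \<Rightarrow> int" where "(\<Sum>i<d. f i) = y + 2 * m + 2 * k + 1"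
    "(\<Sum>i<d. twice_runner_energy d i (f i))
       = int d * y * (y - 1) + 2 * int d * (m\<^sup>2 + k\<^sup>2 + k) + 2 * int r"
proof -
  obtain t where t: "d = r + t" "0 < t" using r less_imp_add_positive by blast
  have "t \<noteq> r" using d(1) t(1) by auto
  obtain \<rho> :: nat where \<rho>: "0 < \<rho>" "\<rho> \<le> 2" "r \<noteq> \<rho>" "t \<noteq> \<rho>"
  proof (cases "r = 1 \<or> t = 1")
    case True
    then show ?thesis using d(2) t(1) by (intro that[of 2]) auto
  qed (auto intro: that[of 1])
  obtain e where e: "d = \<rho> + e" using \<rho>(2) d(2) by (intro that[of "d - \<rho>"]) simp
  have e0: "e \<noteq> 0" "e \<noteq> \<rho>" using e \<rho>(2) d(2) by simp_all
  have er: "r \<noteq> e" "t \<noteq> e" using e t(1) \<rho>(3,4) by auto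
  have "\<rho> \<noteq> 0" "r \<noteq> 0" "t \<noteq> 0" using \<rho>(1) r(1) t(2) by simp_all
  note dist = this e0 er \<rho>(3,4) \<open>t \<noteq> r\<close>
  have lt: "0 < d" "\<rho> < d" "e < d" "r < d" "t < d"
  proof -
    show "0 < d" "r < d" "t < d" using t(1,2) r(1) by simp_all
    show "\<rho> < d" "e < d" using e \<rho>(1) e0(1) by simp_all
  qed
  define f where "f = (\<lambda>_ :: nat. 0 :: int)(0 := y, \<rho> := m, e := m, r := k + 1, t := k)"
  have i: "int e = int d - int \<rho>" "int t = int d - int r" using e t(1) by simp_all
  show ?thesis
  proof (rule that[of f])
    show "(\<Sum>i<d. f i) = y + 2 * m + 2 * k + 1"
      unfolding f_def by (simp only: sum_fun_upd[of _ _ "\<lambda>_ x. x"] lt) (use dist in simp)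
    show "(\<Sum>i<d. twice_runner_energy d i (f i))
       = int d * y * (y - 1) + 2 * int d * (m\<^sup>2 + k\<^sup>2 + k) + 2 * int r"
      unfolding f_def by (simp only: sum_fun_upd[of _ _ "twice_runner_energy d"] lt)
        (use dist in \<open>simp add: twice_runner_energy_def i power2_eq_square algebra_simps\<close>)
  qed
qed

text \<open>For \<open>n \<ge> 2\<close> write \<open>n = d k + r + r'\<close> with \<open>0 < r, r' < d\<close>, and \<open>k\<close> as a sum of three triangular numbers. Two
of these come from the first two components: in the previous lemma take \<open>(x, - x)\<close> and \<open>(- z, z - 1)\<close> for its
\<open>(m, k)\<close>, with energies \<open>d x (2 x - 1) + r\<close> and \<open>d z (2 z - 1) + r'\<close>, contributing \<open>1\<close> and \<open>- 1\<close> to the charge. The third comes from charge \<open>y\<close> on the runners \<open>0\<close> of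
these components and \<open>- y\<close> on a pair of opposite runners of the third, at cost \<open>d (y (y - 1) + y\<^sup>2)\<close>.\<close>
lemma realizable_odd:
  assumes d: "odd d" "5 \<le> d" and s: "s = 0 \<or> s = 1"
  shows "realizable 3 d s (int n)"
proof -
  have lt: "0 < d" "1 < d" "d - 1 < d" and dist: "d - 1 \<noteq> 0" "d - 1 \<noteq> 1"
    and pred: "int (d - 1) = int d - 1"
    using d by auto
  note d0 = lt(1)
  have build: "realizable 3 d s (int n)" if
    "(\<Sum>i<d. f0 i) + (\<Sum>i<d. f1 i) + (\<Sum>i<d. f2 i) = s"
    "(\<Sum>i<d. twice_runner_energy d i (f0 i)) + (\<Sum>i<d. twice_runner_energy d i (f1 i))
      + (\<Sum>i<d. twice_runner_energy d i (f2 i)) = 2 * int n" for f0 f1 f2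
    by (rule realizable_abacus[OF d0, where N = "\<lambda>a. [f0, f1, f2] ! a"])
      (use that in \<open>simp_all add: numeral_3_eq_3 numeral_2_eq_2\<close>)
  \<comment> \<open>Charge \<open>s\<close> on a runner \<open>0\<close> costs no energy, as \<open>s\<close> is \<open>0\<close> or \<open>1\<close>.\<close>
  let ?z = "\<lambda>_ :: nat. 0 :: int"
  consider "n = 0" | "n = 1" | "2 \<le> n" by linarith
  then show ?thesis
  proof cases
    case 1
    have "(\<Sum>i<d. (?z(0 := s)) i) = s"
      using sum_fun_upd[OF d0, of "\<lambda>_ x. x" ?z s] by simp
    moreover have "(\<Sum>i<d. twice_runner_energy d i ((?z(0 := s)) i)) = 0"
      using sum_fun_upd[OF d0, of "twice_runner_energy d" ?z s] s
      by (auto simp: twice_runner_energy_def)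
    ultimately show ?thesis using 1 by (intro build[of "?z(0 := s)" ?z ?z]) simp_all
  next
    case 2
    have "(\<Sum>i<d. (?z(0 := s)) i) = s"
      using sum_fun_upd[OF d0, of "\<lambda>_ x. x" ?z s] by simp
    moreover have "(\<Sum>i<d. twice_runner_energy d i ((?z(0 := s)) i)) = 0"
      using sum_fun_upd[OF d0, of "twice_runner_energy d" ?z s] s
      by (auto simp: twice_runner_energy_def)
    moreover have "(\<Sum>i<d. (?z(0 := 1, d - 1 := - 1)) i) = 0"
      by (simp only: sum_fun_upd[of _ _ "\<lambda>_ x. x"] lt) (use dist in simp)
    moreover have "(\<Sum>i<d. twice_runner_energy d i ((?z(0 := 1, d - 1 := - 1)) i)) = 2"
      by (simp only: sum_fun_upd[of _ _ "twice_runner_energy d"] lt)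
        (use dist in \<open>simp add: twice_runner_energy_def pred\<close>)
    ultimately show ?thesis
      using 2 by (intro build[of "?z(0 := s)" "?z(0 := 1, d - 1 := - 1)" ?z]) simp_all
  next
    case 3
    define k where "k = (n - 2) div d"
    define b where "b = (n - 2) mod d"
    have n: "n = d * k + b + 2" using 3 by (simp add: k_def b_def)
    have b: "b < d" using d0 by (simp add: b_def)
    \<comment> \<open>\<open>r = 1\<close> works unless it would need \<open>r' = d\<close>.\<close>
    obtain r r' where r: "0 < r" "r < d" "0 < r'" "r' < d" "r + r' = b + 2"
    proof (cases "b = d - 1")
      case True
      then show ?thesis using d by (intro that[of 2 "d - 1"]) auto
    next
      case False
      then show ?thesis using d b by (intro that[of 1 "b + 1"]) auto
    qed
    obtain x y z where xyz: "int k = x * (2 * x - 1) + y * (2 * y - 1) + z * (2 * z - 1)"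
      by (rule sum_of_three_hexagonal)
    obtain f0 where f0: "(\<Sum>i<d. f0 i) = y + 2 * x + 2 * (- x) + 1"
      "(\<Sum>i<d. twice_runner_energy d i (f0 i))
         = int d * y * (y - 1) + 2 * int d * (x\<^sup>2 + (- x)\<^sup>2 + (- x)) + 2 * int r"
      by (rule runners_with_odd_pair[OF d r(1,2)])
    obtain f1 where f1: "(\<Sum>i<d. f1 i) = y + 2 * (- z) + 2 * (z - 1) + 1"
      "(\<Sum>i<d. twice_runner_energy d i (f1 i))
         = int d * y * (y - 1) + 2 * int d * ((- z)\<^sup>2 + (z - 1)\<^sup>2 + (z - 1)) + 2 * int r'"
      by (rule runners_with_odd_pair[OF d r(3,4)])
    define f2 where "f2 = ?z(0 := s, 1 := - y, d - 1 := - y)"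
    have f2: "(\<Sum>i<d. f2 i) = s - 2 * y"
      unfolding f2_def by (simp only: sum_fun_upd[of _ _ "\<lambda>_ x. x"] lt) (use dist in simp)
    have f2': "(\<Sum>i<d. twice_runner_energy d i (f2 i)) = 2 * int d * y\<^sup>2"
      unfolding f2_def by (simp only: sum_fun_upd[of _ _ "twice_runner_energy d"] lt)
        (use dist s in \<open>auto simp: twice_runner_energy_def pred power2_eq_square algebra_simps\<close>)
    show ?thesis
    proof (rule build[of f0 f1 f2])
      show "(\<Sum>i<d. f0 i) + (\<Sum>i<d. f1 i) + (\<Sum>i<d. f2 i) = s"
        unfolding f0 f1 f2 by simp
      have "int r + int r' = int b + 2" using r(5) by linarith
      moreover have "int n = int d * int k + int b + 2" unfolding n by simp
      ultimately have "2 * int n = 2 * (int d * int k) + 2 * int r + 2 * int r'" by simp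
      then show "(\<Sum>i<d. twice_runner_energy d i (f0 i)) + (\<Sum>i<d. twice_runner_energy d i (f1 i))
          + (\<Sum>i<d. twice_runner_energy d i (f2 i)) = 2 * int n"
        unfolding f0 f1 f2' xyz by (simp add: power2_eq_square algebra_simps)
    qed
  qed
qed

lemma realizable_step_ge_2:
  assumes "2 \<le> d" "3 \<le> l" "s = 0 \<or> s = 1"
  shows "realizable l d s (int n)"
proof -
  have "d = 3 \<or> 5 \<le> d" if "odd d"
    using that assms(1) by (cases "d = 2 \<or> d = 3 \<or> d = 4") auto
  then have "realizable 3 d s (int n)"
    using realizable_even[of d s n] realizable_3_3[of s n] realizable_odd[of d s n] assms by blast
  then show ?thesis using assms(2) by (rule realizable_more_components)
qed

section \<open>Energies that are not represented\<close>

lemma squares_mod_4: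
  "(x\<^sup>2 + y\<^sup>2 + z\<^sup>2) mod 4
     = ((if even x then 0 else 1) + (if even y then 0 else 1) + (if even z then 0 else 1)) mod 4"
  for x y z :: int
proof -
  have sq: "t\<^sup>2 mod 4 = (if even t then 0 else 1)" for t :: int
  proof (cases "even t")
    case True
    then obtain u where "t = 2 * u" by (rule evenE)
    then show ?thesis by (simp add: power_mult_distrib)
  next
    case False
    then have "t\<^sup>2 mod 8 = 1" by (rule odd_square_mod_8)
    then have "t\<^sup>2 mod 4 = 1" using mod_mod_cancel[of 4 8 "t\<^sup>2"] by simp
    then show ?thesis using False by simp
  qed
  have "(x\<^sup>2 + y\<^sup>2 + z\<^sup>2) mod 4 = (x\<^sup>2 mod 4 + y\<^sup>2 mod 4 + z\<^sup>2 mod 4) mod 4"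
    by (intro mod_add_cong) simp_all
  then show ?thesis unfolding sq .
qed

lemma seven_not_sum_of_three_squares: "x\<^sup>2 + y\<^sup>2 + z\<^sup>2 \<noteq> 7" for x y z :: int
proof
  assume eq: "x\<^sup>2 + y\<^sup>2 + z\<^sup>2 = 7"
  have "odd x \<and> odd y \<and> odd z"
    using squares_mod_4[of x y z] unfolding eq by (simp split: if_splits)
  then have "x\<^sup>2 mod 8 = 1" "y\<^sup>2 mod 8 = 1" "z\<^sup>2 mod 8 = 1" by (simp_all add: odd_square_mod_8)
  moreover have "(x\<^sup>2 + y\<^sup>2 + z\<^sup>2) mod 8 = (x\<^sup>2 mod 8 + y\<^sup>2 mod 8 + z\<^sup>2 mod 8) mod 8"
    by (intro mod_add_cong) simp_all
  ultimately show False unfolding eq by simp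
qed

lemma twenty_eight_not_sum_of_three_squares: "x\<^sup>2 + y\<^sup>2 + z\<^sup>2 \<noteq> 28" for x y z :: int
proof
  assume eq: "x\<^sup>2 + y\<^sup>2 + z\<^sup>2 = 28"
  have "even x \<and> even y \<and> even z"
    using squares_mod_4[of x y z] unfolding eq by (simp split: if_splits)
  then obtain a b c where "x = 2 * a" "y = 2 * b" "z = 2 * c" by (meson evenE)
  then have "a\<^sup>2 + b\<^sup>2 + c\<^sup>2 = 7" using eq by (simp add: power_mult_distrib)
  then show False using seven_not_sum_of_three_squares by blast
qed

lemma not_realizable_3: "\<not> realizable 3 1 1 3"
proof
  assume "realizable 3 1 1 3"
  then obtain N :: "nat \<Rightarrow> int" where "(\<Sum>a<3. N a) = 1" "(\<Sum>a<3. (N a)\<^sup>2) = 2 * 3 + 1"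
    by (rule realizable_1_imp_charges)
  then show False
    using seven_not_sum_of_three_squares[of "N 0" "N 1" "N 2"]
    by (simp add: eval_nat_numeral)
qed

text \<open>If \<open>a + b + c + e = 0\<close> then \<open>a\<^sup>2 + b\<^sup>2 + c\<^sup>2 + e\<^sup>2 = (a + b)\<^sup>2 + (b + c)\<^sup>2 + (a + c)\<^sup>2\<close>.\<close>
lemma not_realizable_4: "\<not> realizable 4 1 0 14"
proof
  assume "realizable 4 1 0 14"
  then obtain N :: "nat \<Rightarrow> int" where N: "(\<Sum>a<4. N a) = 0" "(\<Sum>a<4. (N a)\<^sup>2) = 2 * 14 + 0"
    by (rule realizable_1_imp_charges)
  have four: "(\<Sum>a<4. f a) = f 0 + f 1 + f 2 + f 3" for f :: "nat \<Rightarrow> int"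
    by (simp add: eval_nat_numeral)
  have N3: "N 3 = - (N 0 + N 1 + N 2)" using N(1) unfolding four by linarith
  have "(N 0 + N 1)\<^sup>2 + (N 1 + N 2)\<^sup>2 + (N 0 + N 2)\<^sup>2 = 28"
    using N(2) unfolding four N3 by (simp add: power2_eq_square algebra_simps)
  then show False using twenty_eight_not_sum_of_three_squares by blast
qed

theorem theorem4p18:
  fixes l d :: nat
  assumes "l \<ge> 3" and "d \<ge> 1"
  shows "((\<forall>n. num_cores l d 1 n > 0) \<longleftrightarrow> l * d \<ge> 4) \<and>
         ((\<forall>n. num_cores l d 0 n > 0) \<longleftrightarrow> l * d \<ge> 5)"
proof (cases "d = 1")
  case False
  then have d: "2 \<le> d" using assms by simp
  have "3 * 2 \<le> l * d" using assms d by (intro mult_le_mono)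
  then show ?thesis
    using assms num_cores_pos_of_realizable[OF _ _ _ realizable_step_ge_2[OF d assms(1)]] by auto
next
  case True
  have pos: "num_cores l 1 s n > 0" if "s = 1 \<and> 4 \<le> l \<or> s = 0 \<and> 5 \<le> l" for s n
    using num_cores_pos_of_realizable[OF _ _ _ realizable_unit[OF that]] assms that by auto
  have neg1: "\<not> num_cores l 1 1 3 > 0" if "l < 4"
  proof -
    have "l = 3" using that assms by simp
    then show ?thesis
      using realizable_of_num_unit_cores_pos[of l 1 3] not_realizable_3 by auto
  qed
  have neg0: "\<not> num_cores l 1 0 14 > 0" if "l < 5"
  proof
    assume "num_cores l 1 0 14 > 0"
    then have "realizable l 1 0 14"
      using realizable_of_num_unit_cores_pos[of l 0 14] assms by auto
    then have "realizable 4 1 0 14"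
      by (rule realizable_more_components) (use that in simp)
    then show False using not_realizable_4 by blast
  qed
  have "(\<forall>n. num_cores l 1 1 n > 0) \<longleftrightarrow> 4 \<le> l"
    using pos[of 1] neg1 by (cases "4 \<le> l") auto
  moreover have "(\<forall>n. num_cores l 1 0 n > 0) \<longleftrightarrow> 5 \<le> l"
    using pos[of 0] neg0 by (cases "5 \<le> l") auto
  ultimately show ?thesis unfolding True by simp
qed

end
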